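(* Let $(A_i)_{i\in I}$ be the collection of all infinite arithmetic progressions $\{mh+b : h=0,1,2,\dots\}$ (with $m,b$ positive integers) consisting of positive odd integers and contained in $\mathcal{U}$. Let $J\subseteq I$ be the set of indices $i$ such that the common difference of $A_i$ is the product of a power of $2$ and a squarefree odd integer, and let $K\subseteq I$ be the set of indices $i$ such that the common difference of $A_i$ is squarefree. Then: (i) $\bigcup_{i\in I}A_i=\bigcup_{i\in J}A_i$; (ii) if there are infinitely many Mersenne primes, then $\bigcup_{i\in I}A_i=\bigcup_{i\in K}A_i$.
   Context: $\mathcal{U}$ denotes the set of positive odd integers $n$ that cannot be written as $n=p+2^k$ with $p$ a prime and $k$ a positive integer. A Mersenne prime is a prime of the form $2^r-1$. *)

theory Defs
  imports "HOL-Computational_Algebra.Primes" "HOL-Computational_Algebra.Squarefree"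
begin

definition U_set :: "nat set" where
  "U_set = {n. odd n \<and> \<not> (\<exists>p k. prime p \<and> k > 0 \<and> n = p + 2 ^ k)}"

definition mersenne_prime :: "nat \<Rightarrow> bool" where
  "mersenne_prime p \<longleftrightarrow> prime p \<and> (\<exists>r. p = 2 ^ r - 1)"

definition arith_prog :: "nat \<Rightarrow> nat \<Rightarrow> nat set" where
  "arith_prog m b = {m * h + b | h. True}"

text \<open>
  The progressions are indexed by the pairs (common difference, first term); since the
  common difference is positive, such a pair is determined by the progression as a set.
\<close>

definition prog_I :: "(nat \<times> nat) set" where
  "prog_I = {(m, b). m > 0 \<and> b > 0 \<and> (\<forall>n \<in> arith_prog m b. n > 0 \<and> odd n) \<and>
                     arith_prog m b \<subseteq> U_set}"

definition prog_J :: "(nat \<times> nat) set" where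
  "prog_J = {(m, b) \<in> prog_I. \<exists>k s. m = 2 ^ k * s \<and> odd s \<and> squarefree s}"

definition prog_K :: "(nat \<times> nat) set" where
  "prog_K = {(m, b) \<in> prog_I. squarefree m}"

end

theory Submission
  imports Defs "HOL-Number_Theory.Number_Theory"
begin

text \<open>
  Let a progression with difference \<open>m\<close> lie in \<open>U_set\<close> and let \<open>n\<close> be one of its elements. If
  \<open>n - 2^k\<close> were coprime to \<open>m\<close> for some \<open>k > 0\<close>, Dirichlet's theorem would give a prime \<open>p\<close> with
  \<open>p + 2^k\<close> in the progression. So every \<open>n - 2^k\<close> is divisible by some odd prime divisor \<open>q\<close> of
  \<open>m\<close>, and the same holds for all \<open>n'\<close> congruent to \<open>n\<close> modulo the product \<open>R\<close> of these primes.
  Hence \<open>n' = p + 2^k\<close> is only possible with \<open>p = q\<close> dividing \<open>R\<close>. These finitely many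
  families are excluded by enlarging the modulus: a high power of 2 bounds \<open>k\<close>, while modulo a
  large Mersenne prime the powers of 2 are so few that \<open>n = q + 2^j\<close> would follow.

  Dirichlet's theorem is obtained by Mertens-style estimates for \<open>\<Sum> \<chi>(n) \<Lambda>(n) / n\<close>. For real
  characters \<open>L(1, \<chi>) \<noteq> 0\<close> follows from Monsky's argument with the Lambert series
  \<open>\<Sum> \<chi>(n) x^n / (1 - x^n)\<close>. For complex ones, two vanishing values (at \<open>\<chi>\<close> and its conjugate) would
  make \<open>\<Sum> \<Lambda>(n) / n\<close> over \<open>n \<equiv> 1\<close> negative.
\<close>

section \<open>Dirichlet characters\<close>

text \<open>The set \<open>H\<close> stands for a subgroup of the unit group modulo
  \<open>m\<close>, stored as the union of its residue classes, and \<open>\<chi>\<close> for a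
  homomorphism on it. No quotient structure is formed, and values outside \<open>H\<close> are left
  unconstrained.\<close>

definition char_on :: "nat \<Rightarrow> nat set \<Rightarrow> (nat \<Rightarrow> complex) \<Rightarrow> bool" where
  "char_on m H \<chi> \<longleftrightarrow> 1 \<in> H \<and> \<chi> 1 = 1 \<and> (\<forall>x\<in>H. coprime x m) \<and>
     (\<forall>x\<in>H. \<forall>y. [x = y] (mod m) \<longrightarrow> y \<in> H \<and> \<chi> y = \<chi> x) \<and>
     (\<forall>x\<in>H. \<forall>y\<in>H. x * y \<in> H \<and> \<chi> (x * y) = \<chi> x * \<chi> y)"

lemma char_onD:
  assumes "char_on m H \<chi>"
  shows "1 \<in> H" "\<chi> 1 = 1"
    "\<And>x. x \<in> H \<Longrightarrow> coprime x m"
    "\<And>x y. x \<in> H \<Longrightarrow> [x = y] (mod m) \<Longrightarrow> y \<in> H"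
    "\<And>x y. x \<in> H \<Longrightarrow> [x = y] (mod m) \<Longrightarrow> \<chi> y = \<chi> x"
    "\<And>x y. x \<in> H \<Longrightarrow> y \<in> H \<Longrightarrow> x * y \<in> H"
    "\<And>x y. x \<in> H \<Longrightarrow> y \<in> H \<Longrightarrow> \<chi> (x * y) = \<chi> x * \<chi> y"
  using assms unfolding char_on_def by blast+

lemma char_on_power:
  assumes "char_on m H \<chi>" "x \<in> H"
  shows "x ^ k \<in> H" "\<chi> (x ^ k) = \<chi> x ^ k"
proof -
  have "x ^ k \<in> H \<and> \<chi> (x ^ k) = \<chi> x ^ k"
  proof (induction k)
    case 0
    show ?case using char_onD(1,2)[OF assms(1)] by simp
  next
    case (Suc k)
    thus ?case using char_onD(6,7)[OF assms(1) assms(2), of "x ^ k"] by simp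
  qed
  thus "x ^ k \<in> H" "\<chi> (x ^ k) = \<chi> x ^ k" by auto
qed

lemma char_on_inverse:
  assumes "char_on m H \<chi>" "x \<in> H" "m > 0"
  obtains y where "y \<in> H" "[x * y = 1] (mod m)" "\<chi> x * \<chi> y = 1"
proof -
  \<comment> \<open>The exponent \<open>totient m - 1\<close> makes \<open>y\<close> an inverse by
    Euler's theorem; as a power of \<open>x\<close> it stays in \<open>H\<close>.\<close>
  define y where "y = x ^ (totient m - 1)"
  have "x * y = x ^ totient m"
    using assms(3) unfolding y_def by (metis Suc_diff_1 power_Suc totient_gt_0_iff)
  hence c: "[x * y = 1] (mod m)"
    using euler_theorem[OF char_onD(3)[OF assms(1,2)]] by simp
  have y: "y \<in> H" unfolding y_def by (rule char_on_power[OF assms(1,2)])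
  have "\<chi> (x * y) = 1"
    using char_onD(5)[OF assms(1) char_onD(1)[OF assms(1)] cong_sym[OF c]] char_onD(2)[OF assms(1)]
    by simp
  hence "\<chi> x * \<chi> y = 1" using char_onD(7)[OF assms(1,2) y] by simp
  with c y show ?thesis using that by blast
qed

lemma char_on_nonzero: "char_on m H \<chi> \<Longrightarrow> x \<in> H \<Longrightarrow> m > 0 \<Longrightarrow> \<chi> x \<noteq> 0"
  by (erule (2) char_on_inverse) auto

lemma char_on_cancel:
  assumes "char_on m H \<chi>" "x \<in> H" "x * y \<in> H" "m > 0"
  shows "y \<in> H"
proof -
  obtain x' where x': "x' \<in> H" "[x * x' = 1] (mod m)"
    using char_on_inverse[OF assms(1,2,4)] by blast
  have "x' * (x * y) \<in> H" by (rule char_onD(6)[OF assms(1) x'(1) assms(3)])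
  moreover have "[x' * (x * y) = y] (mod m)"
    using cong_scalar_right[OF x'(2), of y] by (simp add: mult_ac)
  ultimately show ?thesis using char_onD(4)[OF assms(1)] by blast
qed

text \<open>A partial character is extended to \<open>H\<close> and \<open>x\<close> by \<open>h x\<^sup>j \<mapsto> \<chi> h z\<^sup>j\<close>, where \<open>k\<close> is the order of
  \<open>x\<close> modulo \<open>H\<close>. Any \<open>k\<close>-th root \<open>z\<close> of \<open>\<chi> (x\<^sup>k)\<close> will do.\<close>

lemma char_on_extend:
  assumes ch: "char_on m H \<chi>" and m: "m > 0" and x: "coprime x m"
    and k: "k > 0" "x ^ k \<in> H" "\<And>j. 0 < j \<Longrightarrow> j < k \<Longrightarrow> x ^ j \<notin> H"
    and z: "z ^ k = \<chi> (x ^ k)"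
  obtains H' \<chi>' where "char_on m H' \<chi>'" "H \<subseteq> H'" "\<And>h. h \<in> H \<Longrightarrow> \<chi>' h = \<chi> h"
    "x \<in> H'" "\<chi>' x = z"
proof -
  note D = char_onD[OF ch]
  \<comment> \<open>Since \<open>k\<close> is the least positive exponent with \<open>x ^ k\<close>
    in \<open>H\<close>, every such exponent is a multiple of \<open>k\<close>, and the choice of
    \<open>z\<close> fixes \<open>\<chi>\<close> there.\<close>
  have pow: "k dvd j \<and> \<chi> (x ^ j) = z ^ j" if "x ^ j \<in> H" for j
  proof -
    have e: "x ^ j = (x ^ k) ^ (j div k) * x ^ (j mod k)"
      by (metis mult_div_mod_eq power_add power_mult)
    have "x ^ (j mod k) \<in> H"
      using char_on_cancel[OF ch char_on_power(1)[OF ch k(2)] _ m] that e by metis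
    hence "j mod k = 0" using k(1,3) by (meson gr0I mod_less_divisor)
    hence "k dvd j" by auto
    then obtain t where t: "j = k * t" by auto
    show ?thesis using char_on_power(2)[OF ch k(2), of t]
      by (simp add: t power_mult z)
  qed
  \<comment> \<open>Well-definedness: cancelling \<open>x ^ i\<close> puts
    \<open>x ^ (j - i)\<close> into \<open>H\<close>, where \<open>pow\<close> evaluates
    \<open>\<chi>\<close>.\<close>
  have wd': "\<chi> h * z ^ i = \<chi> h' * z ^ j"
    if "h \<in> H" "h' \<in> H" "[h * x ^ i = h' * x ^ j] (mod m)" "i \<le> j" for h h' i j
  proof -
    have "h' * x ^ j = h' * x ^ (j - i) * x ^ i"
      using that(4) by (metis le_add_diff_inverse2 mult.assoc power_add)
    hence c: "[h = h' * x ^ (j - i)] (mod m)"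
      using that(3) x cong_mult_rcancel_nat[of "x ^ i" m h "h' * x ^ (j - i)"]
      by (metis coprime_power_left_iff)
    have in1: "h' * x ^ (j - i) \<in> H" using D(4)[OF that(1) c] .
    hence in2: "x ^ (j - i) \<in> H" using char_on_cancel[OF ch that(2) _ m] by blast
    have "\<chi> h = \<chi> (h' * x ^ (j - i))" using D(5)[OF that(1) c] by simp
    also have "\<dots> = \<chi> h' * z ^ (j - i)" using D(7)[OF that(2) in2] pow[OF in2] by simp
    finally show ?thesis using that(4) by (simp flip: power_add add: mult.assoc)
  qed
  have wd: "\<chi> h * z ^ i = \<chi> h' * z ^ j"
    if "h \<in> H" "h' \<in> H" "[h * x ^ i = h' * x ^ j] (mod m)" for h h' i j
    using wd'[OF that] wd'[OF that(2,1) cong_sym[OF that(3)]] by (cases "i \<le> j") auto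
  \<comment> \<open>\<open>R\<close> is the graph of the extended character. Single-valuedness is
    \<open>wd\<close>, and the domain and the values are read off from \<open>R\<close>.\<close>
  define R where "R n c \<longleftrightarrow> (\<exists>h\<in>H. \<exists>j. [n = h * x ^ j] (mod m) \<and> c = \<chi> h * z ^ j)" for n c
  define H' where "H' = {n. \<exists>c. R n c}"
  define \<chi>' where "\<chi>' n = (THE c. R n c)" for n
  have Runique: "c = c'" if R: "R n c" "R n c'" for n c c'
  proof -
    obtain h i where h: "h \<in> H" "[n = h * x ^ i] (mod m)" "c = \<chi> h * z ^ i"
      using R(1) unfolding R_def by blast
    obtain g j where g: "g \<in> H" "[n = g * x ^ j] (mod m)" "c' = \<chi> g * z ^ j"
      using R(2) unfolding R_def by blast
    show ?thesis using wd[OF h(1) g(1) cong_trans[OF cong_sym[OF h(2)] g(2)]] h(3) g(3) by simp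
  qed
  have val: "\<chi>' n = c" if "R n c" for n c
    unfolding \<chi>'_def using that Runique by blast
  have Rmult: "R (a * b) (c * d)" if R: "R a c" "R b d" for a b c d
  proof -
    obtain h i where h: "h \<in> H" "[a = h * x ^ i] (mod m)" "c = \<chi> h * z ^ i"
      using R(1) unfolding R_def by blast
    obtain g j where g: "g \<in> H" "[b = g * x ^ j] (mod m)" "d = \<chi> g * z ^ j"
      using R(2) unfolding R_def by blast
    have "[a * b = (h * g) * x ^ (i + j)] (mod m)"
      using cong_mult[OF h(2) g(2)] by (simp add: power_add mult_ac)
    moreover have "c * d = \<chi> (h * g) * z ^ (i + j)"
      using D(7)[OF h(1) g(1)] h(3) g(3) by (simp add: power_add mult_ac)
    ultimately show ?thesis unfolding R_def using D(6)[OF h(1) g(1)] by blast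
  qed
  have RH: "R h (\<chi> h)" if "h \<in> H" for h
    unfolding R_def using that by (intro bexI[of _ h] exI[of _ 0]) auto
  have Rx: "R x z"
    unfolding R_def using D(1,2) by (intro bexI[of _ 1] exI[of _ 1]) auto
  have Rcong: "R n' c" if "R n c" "[n = n'] (mod m)" for n n' c
    using that unfolding R_def by (meson cong_sym cong_trans)
  have cop: "coprime n m" if R: "R n c" for n c
  proof -
    obtain h j where h: "h \<in> H" "[n = h * x ^ j] (mod m)" using R unfolding R_def by blast
    have "coprime (h * x ^ j) m" using D(3)[OF h(1)] x by simp
    thus ?thesis using h(2) by (metis cong_gcd_eq coprime_iff_gcd_eq_1)
  qed
  have "char_on m H' \<chi>'"
    unfolding char_on_def
  proof (intro conjI ballI allI impI)
    show "1 \<in> H'" "\<chi>' 1 = 1" using RH[OF D(1)] val D(2) unfolding H'_def by auto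
    fix a assume a: "a \<in> H'"
    then obtain c where c: "R a c" by (auto simp: H'_def)
    show "coprime a m" using cop[OF c] .
    { fix y assume "[a = y] (mod m)"
      from Rcong[OF c this] show "y \<in> H'" "\<chi>' y = \<chi>' a" using val c by (auto simp: H'_def) }
    { fix b assume "b \<in> H'"
      then obtain d where d: "R b d" by (auto simp: H'_def)
      from Rmult[OF c d] show "a * b \<in> H'" "\<chi>' (a * b) = \<chi>' a * \<chi>' b"
        using val c d by (auto simp: H'_def) }
  qed
  thus ?thesis
    using that[of H' \<chi>'] RH Rx val by (auto simp: H'_def)
qed

section \<open>Dirichlet characters as total functions on the naturals\<close>

definition dirichlet_char :: "nat \<Rightarrow> (nat \<Rightarrow> complex) \<Rightarrow> bool" where
  "dirichlet_char m \<chi> \<longleftrightarrow> (\<forall>n. \<chi> n \<noteq> 0 \<longleftrightarrow> coprime n m) \<and> (\<forall>a b. \<chi> (a * b) = \<chi> a * \<chi> b) \<and>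
     (\<forall>n. \<chi> (n mod m) = \<chi> n)"

lemma dirichlet_charD:
  assumes "dirichlet_char m \<chi>"
  shows "\<chi> n \<noteq> 0 \<longleftrightarrow> coprime n m" "\<chi> (a * b) = \<chi> a * \<chi> b" "\<chi> (n mod m) = \<chi> n"
  using assms unfolding dirichlet_char_def by blast+

lemma dirichlet_char_one: "dirichlet_char m \<chi> \<Longrightarrow> \<chi> (Suc 0) = 1"
  using dirichlet_charD(1)[of m \<chi> 1] dirichlet_charD(2)[of m \<chi> 1 1] by simp

lemma dirichlet_char_cong: "dirichlet_char m \<chi> \<Longrightarrow> [a = b] (mod m) \<Longrightarrow> \<chi> a = \<chi> b"
  using dirichlet_charD(3)[of m \<chi> a] dirichlet_charD(3)[of m \<chi> b] by (simp add: cong_def)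

lemma dirichlet_char_power: "dirichlet_char m \<chi> \<Longrightarrow> \<chi> (a ^ k) = \<chi> a ^ k"
  by (induction k) (simp_all add: dirichlet_char_one dirichlet_charD(2))

lemma dirichlet_char_root_of_unity:
  assumes "dirichlet_char m \<chi>" "coprime n m"
  shows "\<chi> n ^ totient m = 1"
  using dirichlet_char_cong[OF assms(1) euler_theorem[OF assms(2)]]
    dirichlet_char_power[OF assms(1)] dirichlet_char_one[OF assms(1)] by simp

lemma norm_dirichlet_char:
  assumes "dirichlet_char m \<chi>" "m > 0" "coprime n m"
  shows "norm (\<chi> n) = 1"
proof (rule power_eq_imp_eq_base)
  show "norm (\<chi> n) ^ totient m = 1 ^ totient m"
    using dirichlet_char_root_of_unity[OF assms(1,3)] by (simp flip: norm_power)
qed (use assms(2) in auto)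

lemma norm_dirichlet_char_le:
  assumes "dirichlet_char m \<chi>" "m > 0"
  shows "norm (\<chi> n) \<le> 1"
  using norm_dirichlet_char[OF assms, of n] dirichlet_charD(1)[OF assms(1), of n]
  by (cases "coprime n m") auto

lemma char_on_least_power:
  assumes "char_on m H \<chi>" "coprime x m" "m > 0"
  obtains k where "k > 0" "x ^ k \<in> H" "\<And>j. 0 < j \<Longrightarrow> j < k \<Longrightarrow> x ^ j \<notin> H"
proof -
  define P where "P k \<longleftrightarrow> 0 < k \<and> x ^ k \<in> H" for k
  have "P (totient m)"
    unfolding P_def
    using char_onD(4)[OF assms(1) char_onD(1)[OF assms(1)] cong_sym[OF euler_theorem[OF assms(2)]]]
      assms(3) by simp
  hence "P (Least P)" "\<And>j. j < Least P \<Longrightarrow> \<not> P j"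
    by (auto intro: LeastI dest: not_less_Least)
  thus ?thesis using that unfolding P_def by blast
qed

text \<open>A character on the class of 1 is first extended to the group generated by
  \<open>a\<close> with a value other than 1 at \<open>a\<close>. Among the partial characters
  keeping such a value, one with largest domain is defined on all units, since otherwise it could be
  extended again.\<close>

lemma exists_separating_char:
  assumes m: "m > 0" and a: "coprime a m" "\<not> [a = 1] (mod m)"
  obtains \<chi> where "dirichlet_char m \<chi>" "\<chi> a \<noteq> 1"
proof -
  define P where "P H \<longleftrightarrow> (\<exists>\<chi>. char_on m H \<chi> \<and> a \<in> H \<and> \<chi> a \<noteq> 1)" for H
  have base: "char_on m {n. [n = 1] (mod m)} (\<lambda>_. 1)"
    unfolding char_on_def
  proof (intro conjI ballI allI impI CollectI)
    fix x assume "x \<in> {n. [n = 1] (mod m)}"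
    thus "coprime x m" by (metis mem_Collect_eq cong_gcd_eq coprime_1_left coprime_iff_gcd_eq_1)
  next
    fix x y assume "x \<in> {n. [n = 1] (mod m)}" "[x = y] (mod m)"
    thus "[y = 1] (mod m)" by (metis mem_Collect_eq cong_sym cong_trans)
  next
    fix x y assume "x \<in> {n. [n = 1] (mod m)}" "y \<in> {n. [n = 1] (mod m)}"
    thus "[x * y = 1] (mod m)" using cong_mult[of x 1 m y 1] by simp
  qed auto
  obtain k where k: "k > 0" "a ^ k \<in> {n. [n = 1] (mod m)}"
      "\<And>j. 0 < j \<Longrightarrow> j < k \<Longrightarrow> a ^ j \<notin> {n. [n = 1] (mod m)}"
    using char_on_least_power[OF base a(1) m] by blast
  \<comment> \<open>The order of \<open>a\<close> is at least 2, so a \<open>k\<close>-th root of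
    unity other than 1 is available as the value at \<open>a\<close>.\<close>
  have "k \<noteq> 1" using k(2) a(2) by auto
  hence "k \<ge> 2" using k(1) by auto
  have "\<exists>z::complex. z ^ k = 1 \<and> z \<noteq> 1"
  proof (rule ccontr)
    assume "\<not> ?thesis"
    hence "{z::complex. z ^ k = 1} = {1}" by auto
    thus False using card_roots_unity_eq[OF k(1)] \<open>k \<ge> 2\<close> by simp
  qed
  then obtain z :: complex where z: "z ^ k = 1" "z \<noteq> 1" by blast
  obtain H0 \<chi>0 where H0: "char_on m H0 \<chi>0" "a \<in> H0" "\<chi>0 a = z"
    using char_on_extend[OF base m a(1) k z(1)] by metis
  hence "P H0" using z(2) unfolding P_def by blast
  \<comment> \<open>Representatives below \<open>m\<close> count the residue classes in
    \<open>H\<close>. This bounded measure gives a domain of maximal size.\<close>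
  have bound: "card (H \<inter> {..<m}) \<le> m" for H
    using card_mono[of "{..<m}" "H \<inter> {..<m}"] by simp
  have "\<exists>H. P H \<and> (\<forall>H'. P H' \<longrightarrow> card (H' \<inter> {..<m}) \<le> card (H \<inter> {..<m}))"
    by (rule ex_has_greatest_nat[of P H0 _ "Suc m"]) (use \<open>P H0\<close> bound in \<open>auto simp: less_Suc_eq_le\<close>)
  then obtain H where H: "P H" "\<And>H'. P H' \<Longrightarrow> card (H' \<inter> {..<m}) \<le> card (H \<inter> {..<m})"
    by blast
  obtain \<chi> where \<chi>: "char_on m H \<chi>" "a \<in> H" "\<chi> a \<noteq> 1" using H(1) unfolding P_def by blast
  have full: "x \<in> H" if x: "coprime x m" for x
  proof (rule ccontr)
    assume "x \<notin> H"
    obtain k where k: "k > 0" "x ^ k \<in> H" "\<And>j. 0 < j \<Longrightarrow> j < k \<Longrightarrow> x ^ j \<notin> H"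
      using char_on_least_power[OF \<chi>(1) x m] by blast
    have "card {z. z ^ k = \<chi> (x ^ k)} = k"
      using card_nth_roots[OF char_on_nonzero[OF \<chi>(1) k(2) m] k(1)] .
    then obtain z where z: "z ^ k = \<chi> (x ^ k)" using k(1)
      by (metis (mono_tags, lifting) Collect_empty_eq card.empty less_numeral_extra(3))
    obtain H' \<chi>' where H': "char_on m H' \<chi>'" "H \<subseteq> H'" "\<And>h. h \<in> H \<Longrightarrow> \<chi>' h = \<chi> h" "x \<in> H'"
      using char_on_extend[OF \<chi>(1) m x k z] by metis
    have "P H'" unfolding P_def using H' \<chi> by auto
    have cx: "[x = x mod m] (mod m)" by simp
    have "x mod m \<in> H'" using char_onD(4)[OF H'(1) H'(4) cx] .
    moreover have "x mod m \<notin> H" using char_onD(4)[OF \<chi>(1) _ cong_sym[OF cx]] \<open>x \<notin> H\<close> by blast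
    ultimately have "H \<inter> {..<m} \<subset> H' \<inter> {..<m}" using H'(2) m by auto
    hence "card (H \<inter> {..<m}) < card (H' \<inter> {..<m})" by (intro psubset_card_mono) auto
    with H(2)[OF \<open>P H'\<close>] show False by simp
  qed
  define \<psi> where "\<psi> n = (if coprime n m then \<chi> n else 0)" for n
  have "dirichlet_char m \<psi>"
    unfolding dirichlet_char_def
  proof (intro conjI allI)
    show "\<psi> n \<noteq> 0 \<longleftrightarrow> coprime n m" for n
      using char_on_nonzero[OF \<chi>(1) full m] by (auto simp: \<psi>_def)
    show "\<psi> (x * y) = \<psi> x * \<psi> y" for x y
      using char_onD(7)[OF \<chi>(1) full full] by (auto simp: \<psi>_def)
    show "\<psi> (n mod m) = \<psi> n" for n
      using char_onD(5)[OF \<chi>(1) full, of n "n mod m"] m by (auto simp: \<psi>_def)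
  qed
  moreover have "\<psi> a \<noteq> 1" using \<chi> a by (simp add: \<psi>_def)
  ultimately show ?thesis using that by blast
qed

section \<open>The finite group of characters and its orthogonality relations\<close>

definition principal_char :: "nat \<Rightarrow> nat \<Rightarrow> complex" where
  "principal_char m n = (if coprime n m then 1 else 0)"

lemma dirichlet_char_principal: "m > 0 \<Longrightarrow> dirichlet_char m (principal_char m)"
  by (auto simp: dirichlet_char_def principal_char_def)

lemma dirichlet_char_mult:
  "dirichlet_char m \<chi> \<Longrightarrow> dirichlet_char m \<psi> \<Longrightarrow> dirichlet_char m (\<lambda>n. \<chi> n * \<psi> n)"
  by (auto simp: dirichlet_char_def)

lemma dirichlet_char_cnj: "dirichlet_char m \<chi> \<Longrightarrow> dirichlet_char m (\<lambda>n. cnj (\<chi> n))"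
  by (auto simp: dirichlet_char_def)

text \<open>By periodicity a character is determined by its values below \<open>m\<close>, each of
  which is 0 or a root of unity of order dividing \<open>totient m\<close>.\<close>

lemma finite_dirichlet_chars:
  assumes m: "m > 0"
  shows "finite {\<chi>. dirichlet_char m \<chi>}"
proof -
  let ?Z = "insert 0 {z::complex. z ^ totient m = 1}"
  let ?r = "\<lambda>\<chi>::nat \<Rightarrow> complex. restrict \<chi> {..<m}"
  have "finite ?Z" using m finite_nth_roots[of "totient m" 1] by simp
  hence "finite (PiE {..<m} (\<lambda>_. ?Z))" by (intro finite_PiE) auto
  moreover have "?r ` {\<chi>. dirichlet_char m \<chi>} \<subseteq> PiE {..<m} (\<lambda>_. ?Z)"
    using dirichlet_charD(1) dirichlet_char_root_of_unity by (auto simp: PiE_iff) metis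
  ultimately have "finite (?r ` {\<chi>. dirichlet_char m \<chi>})" by (rule rev_finite_subset)
  moreover have "inj_on ?r {\<chi>. dirichlet_char m \<chi>}"
  proof (rule inj_onI, clarify, rule ext)
    fix \<chi> \<psi> n assume "dirichlet_char m \<chi>" "dirichlet_char m \<psi>" and eq: "?r \<chi> = ?r \<psi>"
    moreover have "\<chi> (n mod m) = \<psi> (n mod m)" using fun_cong[OF eq, of "n mod m"] m by simp
    ultimately show "\<chi> n = \<psi> n" by (simp add: dirichlet_charD(3))
  qed
  ultimately show ?thesis by (rule finite_imageD)
qed

text \<open>Multiplication by a character \<open>\<psi>\<close> with
  \<open>\<psi> n \<noteq> 1\<close> permutes the characters, so the sum is unchanged when
  multiplied by \<open>\<psi> n\<close>.\<close>

lemma sum_over_dirichlet_chars: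
  assumes m: "m > 0" and n: "coprime n m" "\<not> [n = 1] (mod m)"
  shows "(\<Sum>\<chi> | dirichlet_char m \<chi>. \<chi> n) = 0"
proof -
  obtain \<psi> where \<psi>: "dirichlet_char m \<psi>" "\<psi> n \<noteq> 1" using exists_separating_char[OF m n] by blast
  let ?X = "{\<chi>. dirichlet_char m \<chi>}"
  have cancel: "cnj (\<psi> k) * \<psi> k = 1" if "coprime k m" for k
    using norm_dirichlet_char[OF \<psi>(1) m that] by (simp add: complex_norm_square[symmetric] mult.commute)
  have inv: "\<chi> k * \<psi> k * cnj (\<psi> k) = \<chi> k" "\<chi> k * cnj (\<psi> k) * \<psi> k = \<chi> k" if "dirichlet_char m \<chi>" for \<chi> k
    using cancel[of k] dirichlet_charD(1)[OF that, of k] by (cases "coprime k m"; force simp: mult_ac)+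
  have "bij_betw (\<lambda>\<chi> k. \<chi> k * \<psi> k) ?X ?X"
    by (rule bij_betw_byWitness[where f' = "\<lambda>\<chi> k. \<chi> k * cnj (\<psi> k)"])
       (auto simp: inv intro!: dirichlet_char_mult dirichlet_char_cnj[OF \<psi>(1)] \<psi>(1))
  hence "(\<Sum>\<chi>\<in>?X. \<chi> n) = (\<Sum>\<chi>\<in>?X. \<chi> n * \<psi> n)"
    by (rule sum.reindex_bij_betw[symmetric, where g = "\<lambda>\<chi>. \<chi> n"])
  also have "\<dots> = (\<Sum>\<chi>\<in>?X. \<chi> n) * \<psi> n" by (simp add: sum_distrib_right)
  finally have "(\<Sum>\<chi>\<in>?X. \<chi> n) * (1 - \<psi> n) = 0" by (simp add: algebra_simps)
  thus ?thesis using \<psi>(2) by simp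
qed

lemma dirichlet_chars_orthogonality:
  assumes m: "m > 0" and a: "coprime a m"
  shows "(\<Sum>\<chi> | dirichlet_char m \<chi>. cnj (\<chi> a) * \<chi> n) =
    (if [n = a] (mod m) then of_nat (card {\<chi>. dirichlet_char m \<chi>}) else 0)"
proof (cases "coprime n m")
  case False
  hence "\<not> [n = a] (mod m)" using a by (metis cong_gcd_eq coprime_iff_gcd_eq_1)
  moreover have "\<chi> n = 0" if "dirichlet_char m \<chi>" for \<chi> using dirichlet_charD(1)[OF that] False by blast
  ultimately show ?thesis by (simp add: sum.neutral)
next
  case True
  \<comment> \<open>\<open>b\<close> is an inverse of \<open>a\<close> modulo \<open>m\<close>. Then
    \<open>cnj (\<chi> a)\<close> is \<open>\<chi> b\<close>, and the sum becomes one over the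
    values \<open>\<chi> (b * n)\<close>.\<close>
  define b where "b = a ^ (totient m - 1)"
  have "a * b = a ^ totient m" using m unfolding b_def by (metis Suc_diff_1 power_Suc totient_gt_0_iff)
  hence ab: "[a * b = 1] (mod m)" using euler_theorem[OF a] by simp
  have copb: "coprime b m" using a unfolding b_def by simp
  have "cnj (\<chi> a) * \<chi> n = \<chi> (b * n)" if "dirichlet_char m \<chi>" for \<chi>
  proof -
    have "\<chi> a * \<chi> b = 1"
      using dirichlet_char_cong[OF that ab] dirichlet_charD(2)[OF that] dirichlet_char_one[OF that] by simp
    moreover have "cnj (\<chi> a) * \<chi> a = 1"
      using norm_dirichlet_char[OF that m a] by (simp add: complex_norm_square[symmetric] mult.commute)
    ultimately have "cnj (\<chi> a) = \<chi> b"
      by (metis mult.assoc mult.left_neutral mult.right_neutral)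
    thus ?thesis using dirichlet_charD(2)[OF that] by simp
  qed
  hence eq: "(\<Sum>\<chi> | dirichlet_char m \<chi>. cnj (\<chi> a) * \<chi> n) = (\<Sum>\<chi> | dirichlet_char m \<chi>. \<chi> (b * n))"
    by simp
  have iff: "[b * n = 1] (mod m) \<longleftrightarrow> [n = a] (mod m)"
  proof -
    have "[b * n = 1] (mod m) \<longleftrightarrow> [b * n = b * a] (mod m)"
      using ab by (metis cong_sym cong_trans mult.commute)
    thus ?thesis using cong_mult_lcancel_nat[OF copb] by blast
  qed
  show ?thesis
  proof (cases "[n = a] (mod m)")
    case t: True
    hence "\<chi> (b * n) = 1" if "dirichlet_char m \<chi>" for \<chi>
      using dirichlet_char_cong[OF that, of "b * n" 1] iff dirichlet_char_one[OF that] by simp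
    hence "(\<Sum>\<chi> | dirichlet_char m \<chi>. \<chi> (b * n)) = (\<Sum>\<chi> | dirichlet_char m \<chi>. 1)"
      by (intro sum.cong) auto
    thus ?thesis using t eq by simp
  next
    case False
    thus ?thesis using eq sum_over_dirichlet_chars[OF m, of "b * n"] iff copb True by simp
  qed
qed

text \<open>Multiplication by a unit \<open>c\<close> with \<open>\<chi> c \<noteq> 1\<close>
  permutes the residues, so the sum equals \<open>\<chi> c\<close> times itself.\<close>

lemma sum_dirichlet_char_period:
  assumes ch: "dirichlet_char m \<chi>" and m: "m > 0" and np: "\<chi> \<noteq> principal_char m"
  shows "(\<Sum>n<m. \<chi> n) = 0"
proof -
  obtain c where "\<chi> c \<noteq> principal_char m c" using np by blast
  hence c: "coprime c m" "\<chi> c \<noteq> 1"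
    using dirichlet_charD(1)[OF ch, of c] by (auto simp: principal_char_def split: if_splits)
  have inj: "inj_on (\<lambda>n. (c * n) mod m) {..<m}"
  proof (rule inj_onI)
    fix x y assume "x \<in> {..<m}" "y \<in> {..<m}" "c * x mod m = c * y mod m"
    thus "x = y" using cong_mult_lcancel_nat[OF c(1), of x y] by (auto simp: cong_def)
  qed
  have "bij_betw (\<lambda>n. (c * n) mod m) {..<m} {..<m}"
    unfolding bij_betw_def using m by (intro conjI inj endo_inj_surj) auto
  hence "(\<Sum>n<m. \<chi> n) = (\<Sum>n<m. \<chi> ((c * n) mod m))"
    by (rule sum.reindex_bij_betw[symmetric])
  also have "\<dots> = \<chi> c * (\<Sum>n<m. \<chi> n)"
    using dirichlet_charD(2,3)[OF ch] by (simp add: sum_distrib_left)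
  finally have "(1 - \<chi> c) * (\<Sum>n<m. \<chi> n) = 0" by (simp add: algebra_simps)
  thus ?thesis using c(2) by simp
qed

text \<open>Full periods cancel, so each initial sum has norm at most \<open>m\<close>; a sum over
  an interval is a difference of two of them.\<close>

lemma sum_dirichlet_char_bound:
  assumes ch: "dirichlet_char m \<chi>" and m: "m > 0" and np: "\<chi> \<noteq> principal_char m"
  shows "norm (\<Sum>n=M..<N. \<chi> n) \<le> 2 * m"
proof -
  have add: "(\<Sum>n<m*q + r. \<chi> n) = (\<Sum>n<r. \<chi> n)" for q r
  proof (induction q)
    case (Suc q)
    have per: "\<chi> (n + m) = \<chi> n" for n by (rule dirichlet_char_cong[OF ch]) (simp add: cong_def)
    have "(\<Sum>n<m*Suc q + r. \<chi> n) = (\<Sum>n<(m*q + r) + m. \<chi> n)" by (simp add: algebra_simps)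
    also have "\<dots> = (\<Sum>n<m. \<chi> n) + (\<Sum>n\<in>{m..<(m*q + r) + m}. \<chi> n)"
      by (subst sum.union_disjoint[symmetric]) (auto intro!: sum.cong)
    also have "(\<Sum>n\<in>{m..<(m*q + r) + m}. \<chi> n) = (\<Sum>n\<in>{0..<m*q + r}. \<chi> (n + m))"
      using sum.shift_bounds_nat_ivl[of \<chi> 0 m "m * q + r"] by simp
    also have "\<dots> = (\<Sum>n<m*q + r. \<chi> n)" by (simp add: per lessThan_atLeast0)
    finally show ?case using Suc sum_dirichlet_char_period[OF assms] by simp
  qed simp
  have bd: "norm (\<Sum>n<K. \<chi> n) \<le> m" for K
  proof -
    have "(\<Sum>n<K. \<chi> n) = (\<Sum>n<K mod m. \<chi> n)" using add[of "K div m" "K mod m"] by simp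
    also have "norm \<dots> \<le> (\<Sum>n<K mod m. 1)"
      by (rule sum_norm_le) (rule norm_dirichlet_char_le[OF ch m])
    also have "\<dots> \<le> m" using m by (simp add: less_imp_le)
    finally show ?thesis .
  qed
  show ?thesis
  proof (cases "M \<le> N")
    case True
    have "(\<Sum>n=M..<N. \<chi> n) = (\<Sum>n<N. \<chi> n) - (\<Sum>n<M. \<chi> n)"
      using sum_diff_nat_ivl[of 0 M N \<chi>] True by (simp add: lessThan_atLeast0)
    also have "norm \<dots> \<le> m + m" using bd[of N] bd[of M] norm_triangle_ineq4[of "\<Sum>n<N. \<chi> n" "\<Sum>n<M. \<chi> n"] by linarith
    finally show ?thesis by simp
  qed auto
qed

section \<open>Elementary estimates for the von Mangoldt function\<close>

text \<open>The pairs \<open>(n, d)\<close> with \<open>d dvd n\<close> correspond to the pairs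
  \<open>(d, e)\<close> with \<open>d * e \<le> N\<close>.\<close>

lemma sum_divisors_swap:
  fixes f :: "nat \<Rightarrow> nat \<Rightarrow> 'a::comm_monoid_add"
  shows "(\<Sum>n=1..N. \<Sum>d | d dvd n. f d (n div d)) = (\<Sum>d=1..N. \<Sum>e=1..N div d. f d e)"
proof -
  have fin: "finite {d. d dvd n}" if "n \<in> {1..N}" for n :: nat
    using that by (intro finite_divisors_nat) auto
  have "(\<Sum>n=1..N. \<Sum>d | d dvd n. f d (n div d)) =
      (\<Sum>(n, d)\<in>(SIGMA n:{1..N}. {d. d dvd n}). f d (n div d))"
    by (rule sum.Sigma) (use fin in auto)
  also have "\<dots> = (\<Sum>(d, e)\<in>(SIGMA d:{1..N}. {1..N div d}). f d e)"
  proof (rule sum.reindex_bij_witness[of _ "\<lambda>(d, e). (d * e, d)" "\<lambda>(n, d). (d, n div d)"], goal_cases)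
    case (2 x)
    then obtain n d where x: "x = (n, d)" "n \<in> {1..N}" "d dvd n" by auto
    then obtain e where "n = d * e" by auto
    with x show ?case by (auto simp: less_eq_div_iff_mult_less_eq mult.commute Suc_le_eq
          intro: Nat.gr0I dvd_imp_le[of d n, THEN le_trans])
  next
    case (4 y)
    then obtain d e where y: "y = (d, e)" "1 \<le> d" "1 \<le> e" "e \<le> N div d" by auto
    hence "d * e \<le> N" by (simp add: less_eq_div_iff_mult_less_eq mult.commute)
    with y show ?case by (auto simp: Suc_le_eq)
  qed auto
  also have "\<dots> = (\<Sum>d=1..N. \<Sum>e=1..N div d. f d e)"
    by (rule sum.Sigma[symmetric]) auto
  finally show ?thesis .
qed

lemma sum_ln_eq_mangoldt:
  "(\<Sum>n=1..N. ln (real n)) = (\<Sum>d=1..N. mangoldt d * real (N div d))"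
proof -
  have "(\<Sum>n=1..N. ln (real n)) = (\<Sum>n=1..N. \<Sum>d | d dvd n. mangoldt d)"
    by (intro sum.cong) (auto simp: mangoldt_sum)
  also have "\<dots> = (\<Sum>d=1..N. \<Sum>e=1..N div d. mangoldt d)"
    by (rule sum_divisors_swap[where f = "\<lambda>d e. mangoldt d"])
  also have "\<dots> = (\<Sum>d=1..N. mangoldt d * real (N div d))"
    by (simp add: mult.commute)
  finally show ?thesis .
qed

section \<open>Weak Stirling bounds and the estimates of Chebyshev and Mertens\<close>

lemma sum_ln_le: "(\<Sum>n=1..N. ln (real n)) \<le> N * ln N"
proof -
  have "(\<Sum>n=1..N. ln (real n)) \<le> (\<Sum>n=1..N. ln (real N))" by (intro sum_mono) auto
  thus ?thesis by simp
qed

lemma sum_ln_ge: "N * ln N - N \<le> (\<Sum>n=1..N. ln (real n))"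
proof (induction N)
  case (Suc N)
  have "real N * (ln (real (Suc N)) - ln (real N)) \<le> 1"
  proof (cases "N = 0")
    case False
    have "ln (real (Suc N)) - ln (real N) = ln (1 + 1 / real N)"
      using False by (subst ln_divide_pos[symmetric]) (auto simp: field_simps)
    also have "\<dots> \<le> 1 / real N" by (rule ln_add_one_self_le_self) auto
    finally show ?thesis using False by (simp add: field_simps)
  qed auto
  with Suc show ?case by (simp add: algebra_simps)
qed auto

text \<open>Chebyshev's comparison of \<open>ln ((2n)!)\<close> with \<open>2 ln (n!)\<close>: the
  coefficient \<open>2n div d - 2 (n div d)\<close> of \<open>mangoldt d\<close> is never negative
  and equals 1 for \<open>n < d \<le> 2n\<close>. The Stirling bounds leave
  \<open>2n ln 2 + 2n\<close>, which is at most \<open>4n\<close>.\<close>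

lemma chebyshev_psi_double: "(\<Sum>d=1..2*n. mangoldt d) \<le> (\<Sum>d=1..n. mangoldt d) + 4 * real n"
proof -
  have "(\<Sum>d=n+1..2*n. mangoldt d) \<le> (\<Sum>d=1..2*n. mangoldt d * (real (2*n div d) - 2 * real (n div d)))"
  proof -
    have nonneg: "2 * (n div d) \<le> 2 * n div d" for d
      by (metis div_mult1_eq le_add1)
    have "(\<Sum>d=n+1..2*n. mangoldt d) =
        (\<Sum>d=n+1..2*n. mangoldt d * (real (2*n div d) - 2 * real (n div d)))"
    proof (intro sum.cong refl)
      fix d assume d: "d \<in> {n+1..2*n}"
      hence "2 * n div d = 1" "n div d = 0" by (auto intro: div_nat_eqI)
      thus "mangoldt d = mangoldt d * (real (2*n div d) - 2 * real (n div d))" by simp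
    qed
    also have "\<dots> \<le> (\<Sum>d=1..2*n. mangoldt d * (real (2*n div d) - 2 * real (n div d)))"
    proof (rule sum_mono2)
      fix d assume "d \<in> {1..2*n} - {n+1..2*n}"
      have "2 * real (n div d) \<le> real (2 * n div d)" using nonneg[of d] by linarith
      thus "0 \<le> mangoldt d * (real (2*n div d) - 2 * real (n div d))"
        by (intro mult_nonneg_nonneg mangoldt_nonneg) auto
    qed auto
    finally show ?thesis .
  qed
  also have "\<dots> = (\<Sum>d=1..2*n. mangoldt d * real (2*n div d)) - 2 * (\<Sum>d=1..2*n. mangoldt d * real (n div d))"
    by (simp add: sum_subtractf sum_distrib_left algebra_simps)
  also have "(\<Sum>d=1..2*n. mangoldt d * real (n div d)) = (\<Sum>d=1..n. mangoldt d * real (n div d))"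
    by (rule sum.mono_neutral_right) auto
  also have "(\<Sum>d=1..2*n. mangoldt d * real (2*n div d)) - 2 * (\<Sum>d=1..n. mangoldt d * real (n div d)) =
      (\<Sum>k=1..2*n. ln (real k)) - 2 * (\<Sum>k=1..n. ln (real k))"
    by (simp only: sum_ln_eq_mangoldt)
  also have "\<dots> \<le> (2 * n) * ln (2 * n) - 2 * (n * ln n - n)"
    using sum_ln_le[of "2 * n"] sum_ln_ge[of n] by (intro diff_mono mult_left_mono) auto
  also have "\<dots> \<le> 4 * n"
  proof (cases "n = 0")
    case False
    have "ln (2::real) \<le> 1" using ln_le_minus_one[of 2] by simp
    hence "real n * ln 2 \<le> real n * 1" by (intro mult_left_mono) auto
    thus ?thesis using False by (simp add: ln_mult algebra_simps)
  qed auto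
  finally have "(\<Sum>d=n+1..2*n. mangoldt d) \<le> 4 * real n" by simp
  moreover have "(\<Sum>d=1..2*n. mangoldt d) = (\<Sum>d=1..n. mangoldt d) + (\<Sum>d=n+1..2*n. mangoldt d :: real)"
    by (subst sum.union_disjoint[symmetric]) (auto intro!: sum.cong)
  ultimately show ?thesis by simp
qed

text \<open>Repeated halving. The doubling step gives \<open>8k + 4k\<close> at \<open>2k\<close>,
  and an odd \<open>n = 2k + 1\<close> adds at most \<open>ln n \<le> 2k\<close>, which still fits
  under \<open>8n\<close>.\<close>

lemma chebyshev_psi_le: "(\<Sum>d=1..n. mangoldt d) \<le> 8 * real n"
proof (induction n rule: less_induct)
  case (less n)
  show ?case
  proof (cases "n = 0")
    case False
    define k where "k = n div 2"
    have IH: "(\<Sum>d=1..k. mangoldt d) \<le> 8 * real k" using less False by (auto simp: k_def)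
    have double: "(\<Sum>d=1..2*k. mangoldt d) \<le> 12 * real k" using IH chebyshev_psi_double[of k] by simp
    show ?thesis
    proof (cases "even n")
      case True
      thus ?thesis using double by (auto simp: k_def)
    next
      case odd: False
      hence n: "n = Suc (2 * k)" by (auto simp: k_def)
      have "mangoldt n \<le> ln (real n)" using False by (intro mangoldt_le) auto
      also have "\<dots> \<le> real n - 1" using False by (intro ln_le_minus_one) auto
      finally show ?thesis using double unfolding n by simp
    qed
  qed auto
qed

text \<open>In \<open>ln (N!) = \<Sum> mangoldt d * (N div d)\<close> the quotient is at most
  \<open>N / d\<close>.\<close>

lemma mertens_lower:
  assumes "N > 0"
  shows "ln N - 1 \<le> (\<Sum>d=1..N. mangoldt d / d)"
proof -
  have "N * ln N - N \<le> (\<Sum>d=1..N. mangoldt d * real (N div d))"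
    using sum_ln_ge[of N] by (simp only: sum_ln_eq_mangoldt)
  also have "\<dots> \<le> (\<Sum>d=1..N. mangoldt d * (real N / real d))"
    by (intro sum_mono mult_left_mono mangoldt_nonneg of_nat_div_le_of_nat)
  also have "\<dots> = N * (\<Sum>d=1..N. mangoldt d / d)"
    by (simp add: sum_distrib_left mult_ac)
  finally have "N * (ln N - 1) \<le> N * (\<Sum>d=1..N. mangoldt d / d)" by (simp add: algebra_simps)
  thus ?thesis using assms by simp
qed

text \<open>Here \<open>N div d\<close> is at least \<open>N / d - 1\<close>. The loss is a
  Chebyshev sum, at most \<open>8 N\<close>, whence the constant 8.\<close>

lemma mertens_upper:
  assumes "N > 0"
  shows "(\<Sum>d=1..N. mangoldt d / d) \<le> ln N + 8"
proof -
  have "N * (\<Sum>d=1..N. mangoldt d / d) - (\<Sum>d=1..N. mangoldt d) =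
      (\<Sum>d=1..N. mangoldt d * (real N / real d - 1))"
    by (simp add: sum_distrib_left sum_subtractf algebra_simps)
  also have "\<dots> \<le> (\<Sum>d=1..N. mangoldt d * real (N div d))"
  proof (intro sum_mono mult_left_mono mangoldt_nonneg)
    fix d assume d: "d \<in> {1..N}"
    hence "real (N mod d) \<le> real d" by (simp add: less_imp_le)
    hence "real (N mod d) / real d \<le> 1" using d by (simp add: divide_simps)
    thus "real N / real d - 1 \<le> real (N div d)" using of_nat_of_nat_div_aux[of N d, where ?'a = real] by linarith
  qed
  also have "\<dots> \<le> N * ln N"
    using sum_ln_le[of N] by (simp only: sum_ln_eq_mangoldt)
  finally have "N * (\<Sum>d=1..N. mangoldt d / d) \<le> N * (ln N + 8)"
    using chebyshev_psi_le[of N] by (simp add: algebra_simps)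
  thus ?thesis using assms by simp
qed

section \<open>The bounded contribution of higher prime powers\<close>

lemma sum_ln_over_square_le:
  assumes "N \<ge> 1"
  shows "(\<Sum>n=2..N. ln (real n) / real n ^ 2) \<le> 2 - (ln N + 2) / N"
  using assms
proof (induction N rule: dec_induct)
  case (step n)
  define L where "L = ln (real (Suc n))"
  define x where "x = real n"
  have x: "x \<ge> 1" using step(1) by (simp add: x_def)
  have L: "L \<ge> 0" unfolding L_def by simp
  have "L - ln x = ln (1 + 1 / x)"
    using x unfolding L_def x_def by (subst ln_divide_pos[symmetric]) (auto simp: field_simps)
  also have "\<dots> \<le> 1 / x" using x by (intro ln_add_one_self_le_self) auto
  finally have "(L + 2 - 1 / x) / x \<le> (ln x + 2) / x" using x by (intro divide_right_mono) auto
  \<comment> \<open>The bound telescopes: each new term is at most the drop of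
    \<open>(ln x + 2) / x\<close> from \<open>n\<close> to \<open>n + 1\<close>. Here
    \<open>ln x\<close> has been replaced by its lower bound \<open>L - 1 / x\<close>.\<close>
  moreover have "L / (x + 1) ^ 2 \<le> (L + 2 - 1 / x) / x - (L + 2) / (x + 1)"
  proof -
    have "(L + 2 - 1 / x) / x - (L + 2) / (x + 1) - L / (x + 1) ^ 2 =
        (L * x + (x + 1) * (x - 1)) / (x ^ 2 * (x + 1) ^ 2)"
      using x by (simp add: divide_simps) (simp add: algebra_simps power2_eq_square)
    also have "\<dots> \<ge> 0" using x L by (intro divide_nonneg_nonneg add_nonneg_nonneg mult_nonneg_nonneg) auto
    finally show ?thesis by simp
  qed
  ultimately have "L / (x + 1) ^ 2 \<le> (ln x + 2) / x - (L + 2) / (x + 1)" by linarith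
  moreover have "(\<Sum>k=2..Suc n. ln (real k) / real k ^ 2) =
      (\<Sum>k=2..n. ln (real k) / real k ^ 2) + L / (x + 1) ^ 2"
    using step(1) by (simp add: L_def x_def add.commute)
  moreover have "(ln (real (Suc n)) + 2) / real (Suc n) = (L + 2) / (x + 1)"
    by (simp add: L_def x_def add.commute)
  ultimately show ?case using step(3) unfolding x_def by linarith
qed auto

text \<open>Only powers \<open>p ^ k\<close> with \<open>k \<ge> 2\<close> contribute. For each
  \<open>p\<close> the geometric series is at most \<open>2 ln p / p^2\<close>, and these sum to at
  most 4.\<close>

lemma sum_mangoldt_nonprime_le:
  "(\<Sum>n | n \<in> {1..N} \<and> \<not> prime n. mangoldt n / real n) \<le> (4::real)"
proof (cases "N \<ge> 1")
  case True
  let ?A = "{n \<in> {1..N}. \<not> prime n}" and ?B = "{n \<in> {1..N}. \<not> prime n \<and> primepow n}"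
  have "(\<Sum>n\<in>?A. mangoldt n / real n :: real) = (\<Sum>n\<in>?B. mangoldt n / real n)"
    by (rule sum.mono_neutral_right) (auto simp: mangoldt_def)
  \<comment> \<open>The square of pairs is larger than necessary, and its bases need not be prime;
    it suffices that every \<open>n\<close> in \<open>?B\<close> is hit by a pair with a term at
    least as large.\<close>
  also have "\<dots> \<le> (\<Sum>(p, k)\<in>{2..N} \<times> {2..N}. ln (real p) / real p ^ k)"
  proof (rule sum_le_included[where i = "\<lambda>(p, k). p ^ k"])
    show "\<forall>n\<in>?B. \<exists>y\<in>{2..N} \<times> {2..N}. (case y of (p, k) \<Rightarrow> p ^ k) = n \<and>
        mangoldt n / real n \<le> (case y of (p, k) \<Rightarrow> ln (real p) / real p ^ k)"
    proof
      fix n assume n: "n \<in> ?B"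
      then obtain p k where pk: "prime p" "k > 0" "n = p ^ k" by (auto simp: primepow_def)
      have p2: "p \<ge> 2" using pk(1) by (rule prime_ge_2_nat)
      have "k \<noteq> 1" using n pk by auto
      hence k2: "k \<ge> 2" using pk(2) by simp
      have "p \<le> n" using pk p2 by (simp add: self_le_power)
      moreover have "k < n" using pk(3) p2 by (metis less_exp less_le_trans power_mono zero_le)
      ultimately have "(p, k) \<in> {2..N} \<times> {2..N}" using p2 k2 n by auto
      moreover have "mangoldt n / real n = ln (real p) / real p ^ k" using pk by simp
      ultimately show "\<exists>y\<in>{2..N} \<times> {2..N}. (case y of (p, k) \<Rightarrow> p ^ k) = n \<and>
          mangoldt n / real n \<le> (case y of (p, k) \<Rightarrow> ln (real p) / real p ^ k)"
        using pk(3) by (intro bexI[of _ "(p, k)"]) auto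
    qed
  qed auto
  also have "\<dots> = (\<Sum>p=2..N. \<Sum>k=2..N. ln (real p) / real p ^ k)"
    by (simp add: sum.cartesian_product)
  also have "\<dots> \<le> (\<Sum>p=2..N. 2 * (ln (real p) / real p ^ 2))"
  proof (rule sum_mono)
    fix p assume p: "p \<in> {2..N}"
    define q where "q = 1 / real p"
    have q: "0 \<le> q" "q \<le> 1 / 2" using p by (auto simp: q_def field_simps)
    have "(1 - q) * (\<Sum>k=2..N. q ^ k) = q ^ 2 - q ^ Suc N" using True
    proof (induction N rule: dec_induct)
      case (step n)
      have "(1 - q) * (\<Sum>k=2..Suc n. q ^ k) = (1 - q) * (\<Sum>k=2..n. q ^ k) + (1 - q) * q ^ Suc n"
        using step(1) by (simp add: distrib_left)
      thus ?case unfolding step(3) by (simp add: algebra_simps)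
    qed (simp add: power2_eq_square)
    also have "\<dots> \<le> q ^ 2" using q by simp
    finally have "(1 - q) * (\<Sum>k=2..N. q ^ k) \<le> q ^ 2" .
    moreover have "1 / 2 * (\<Sum>k=2..N. q ^ k) \<le> (1 - q) * (\<Sum>k=2..N. q ^ k)"
      using q by (intro mult_right_mono sum_nonneg) auto
    ultimately have "(\<Sum>k=2..N. q ^ k) \<le> 2 * q ^ 2" by linarith
    hence "ln (real p) * (\<Sum>k=2..N. q ^ k) \<le> ln (real p) * (2 * q ^ 2)"
      using p by (intro mult_left_mono) auto
    thus "(\<Sum>k=2..N. ln (real p) / real p ^ k) \<le> 2 * (ln (real p) / real p ^ 2)"
      by (simp add: q_def sum_distrib_left power_divide mult.commute)
  qed
  also have "\<dots> = 2 * (\<Sum>p=2..N. ln (real p) / real p ^ 2)" by (rule sum_distrib_left[symmetric])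
  also have "\<dots> \<le> 2 * (2 - (ln N + 2) / N)" by (intro mult_left_mono sum_ln_over_square_le True) auto
  also have "\<dots> \<le> 4" using True by simp
  finally show ?thesis by simp
qed auto

section \<open>The Moebius function\<close>

definition moebius :: "nat \<Rightarrow> real" where
  "moebius n = (if squarefree n then (-1) ^ card (prime_factors n) else 0)"

lemma abs_moebius_le: "\<bar>moebius n\<bar> \<le> 1"
  by (simp add: moebius_def power_abs)

lemma moebius_1 [simp]: "moebius (Suc 0) = 1"
  by (simp add: moebius_def)

text \<open>For a prime \<open>p\<close> dividing \<open>n\<close>, the squarefree divisors pair off
  as \<open>d\<close> and \<open>p * d\<close> with \<open>d\<close> prime to \<open>p\<close>, and
  their terms cancel.\<close>

lemma sum_moebius_divisors:
  assumes "n > 0"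
  shows "(\<Sum>d | d dvd n. moebius d) = (if n = 1 then 1 else 0)"
proof (cases "n = 1")
  case False
  then obtain p where p: "prime p" "p dvd n" using prime_factor_nat by blast
  define D0 where "D0 = {d. d dvd n \<and> squarefree d \<and> \<not> p dvd d}"
  have fin: "finite {d. d dvd n}" using assms by (rule finite_divisors_nat)
  hence fin0: "finite D0" by (auto simp: D0_def)
  have cop: "coprime p d" if "\<not> p dvd d" for d using that p(1) by (simp add: prime_imp_coprime)
  have split: "{d. d dvd n \<and> squarefree d} = D0 \<union> (*) p ` D0"
  proof (intro equalityI subsetI)
    fix d assume d: "d \<in> {d. d dvd n \<and> squarefree d}"
    show "d \<in> D0 \<union> (*) p ` D0"
    proof (cases "p dvd d")
      case True
      then obtain e where e: "d = p * e" by auto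
      have "\<not> p dvd e"
      proof
        assume "p dvd e"
        hence "p ^ 2 dvd d" by (auto simp: e power2_eq_square)
        hence "p dvd 1" using d unfolding squarefree_def by blast
        thus False using p(1) by (simp add: prime_nat_iff)
      qed
      moreover have "e dvd d" by (simp add: e)
      hence "e dvd n" "squarefree e" using d dvd_trans squarefree_mono by blast+
      ultimately show ?thesis using e by (auto simp: D0_def)
    qed (use d in \<open>auto simp: D0_def\<close>)
  next
    fix d assume "d \<in> D0 \<union> (*) p ` D0"
    then consider "d \<in> D0" | e where "e \<in> D0" "d = p * e" by blast
    thus "d \<in> {d. d dvd n \<and> squarefree d}"
    proof cases
      case 2
      hence e: "e dvd n" "squarefree e" "coprime p e" using cop by (auto simp: D0_def)
      thus ?thesis using 2(2) divides_mult[OF p(2) e(1,3)]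
          squarefree_mult_coprime[OF e(3) squarefree_prime[OF p(1)] e(2)] by simp
    qed (auto simp: D0_def)
  qed
  have "(\<Sum>d | d dvd n. moebius d) = (\<Sum>d | d dvd n \<and> squarefree d. moebius d)"
    by (rule sum.mono_neutral_right) (use fin in \<open>auto simp: moebius_def\<close>)
  also have "\<dots> = (\<Sum>d\<in>D0. moebius d) + (\<Sum>d\<in>(*) p ` D0. moebius d)"
    unfolding split by (rule sum.union_disjoint) (use fin0 in \<open>auto simp: D0_def\<close>)
  also have "(\<Sum>d\<in>(*) p ` D0. moebius d) = (\<Sum>d\<in>D0. moebius (p * d))"
    using p(1) by (subst sum.reindex) (auto simp: inj_on_def)
  also have "\<dots> = (\<Sum>d\<in>D0. - moebius d)"
  proof (intro sum.cong refl)
    fix d assume d: "d \<in> D0"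
    hence d0: "d \<noteq> 0" using assms by (auto simp: D0_def)
    have "prime_factors (p * d) = insert p (prime_factors d)"
      using d0 p(1) by (subst prime_factors_product) (auto simp: prime_prime_factors)
    moreover have "p \<notin> prime_factors d" using d by (auto simp: D0_def)
    moreover have "squarefree (p * d)" using d split by auto
    ultimately show "moebius (p * d) = - moebius d" using d by (simp add: moebius_def D0_def)
  qed
  finally show ?thesis using False by (simp add: sum_negf)
next
  case True
  have "{d. d dvd (1::nat)} = {1}" by auto
  thus ?thesis using True by simp
qed

text \<open>Moebius inversion of \<open>ln n = \<Sum> mangoldt d\<close> over divisors gives
  \<open>mangoldt n = \<Sum> moebius d * ln (n div d)\<close>. After splitting the logarithm, the
  \<open>ln n\<close> part vanishes: the Moebius sum is 0 for \<open>n > 1\<close>, and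
  \<open>ln 1 = 0\<close>.\<close>

lemma mangoldt_eq_sum_moebius:
  assumes "n > 0"
  shows "(\<Sum>d | d dvd n. moebius d * ln (real d)) = - mangoldt n"
proof -
  have fin: "finite {d. d dvd n}" using assms by (rule finite_divisors_nat)
  have "(\<Sum>d | d dvd n. moebius d * ln (real (n div d))) =
      (\<Sum>d | d dvd n. \<Sum>e | e dvd n div d. moebius d * mangoldt e)"
  proof (intro sum.cong refl)
    fix d assume d: "d \<in> {d. d dvd n}"
    hence "n div d \<noteq> 0" using assms by (auto simp: dvd_div_eq_0_iff)
    thus "moebius d * ln (real (n div d)) = (\<Sum>e | e dvd n div d. moebius d * mangoldt e)"
      by (simp add: mangoldt_sum flip: sum_distrib_left)
  qed
  also have "\<dots> = (\<Sum>(d, e)\<in>(SIGMA d:{d. d dvd n}. {e. e dvd n div d}). moebius d * mangoldt e)"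
    by (rule sum.Sigma) (use fin assms in \<open>auto simp: dvd_div_eq_0_iff intro!: finite_divisors_nat Nat.gr0I\<close>)
  also have "\<dots> = (\<Sum>(e, d)\<in>(SIGMA e:{e. e dvd n}. {d. d dvd n div e}). moebius d * mangoldt e)"
  proof -
    have iff: "d dvd n \<and> e dvd n div d \<longleftrightarrow> e dvd n \<and> d dvd n div e" for d e
    proof -
      have "d dvd n \<and> e dvd n div d \<longleftrightarrow> d * e dvd n" for d e
        using assms by (auto simp: dvd_div_iff_mult mult.commute dest: dvd_mult_left dvd_mult_right)
      thus ?thesis by (metis mult.commute)
    qed
    show ?thesis
      by (rule sum.reindex_bij_witness[of _ prod.swap prod.swap]) (use iff in auto)
  qed
  also have "\<dots> = (\<Sum>e | e dvd n. \<Sum>d | d dvd n div e. moebius d * mangoldt e)"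
    by (rule sum.Sigma[symmetric]) (use fin assms in \<open>auto simp: dvd_div_eq_0_iff intro!: finite_divisors_nat Nat.gr0I\<close>)
  also have "\<dots> = (\<Sum>e | e dvd n. if e = n then mangoldt n else 0)"
  proof (intro sum.cong refl)
    fix e assume e: "e \<in> {e. e dvd n}"
    hence "n div e > 0" using assms by (auto simp: dvd_div_eq_0_iff intro!: Nat.gr0I)
    moreover have "n div e = 1 \<longleftrightarrow> e = n" using e assms by auto
    ultimately show "(\<Sum>d | d dvd n div e. moebius d * mangoldt e) = (if e = n then mangoldt n else 0)"
      using sum_moebius_divisors[of "n div e"] by (auto simp flip: sum_distrib_right)
  qed
  also have "\<dots> = mangoldt n" using fin by simp
  finally have 1: "(\<Sum>d | d dvd n. moebius d * ln (real (n div d))) = mangoldt n" .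
  have "(\<Sum>d | d dvd n. moebius d * ln (real (n div d))) =
      (\<Sum>d | d dvd n. moebius d * ln (real n) - moebius d * ln (real d))"
  proof (intro sum.cong refl)
    fix d assume d: "d \<in> {d. d dvd n}"
    hence "d > 0" using assms by (auto intro: Nat.gr0I)
    thus "moebius d * ln (real (n div d)) = moebius d * ln (real n) - moebius d * ln (real d)"
      using d assms by (simp add: real_of_nat_div ln_div algebra_simps)
  qed
  also have "\<dots> = (\<Sum>d | d dvd n. moebius d) * ln (real n) - (\<Sum>d | d dvd n. moebius d * ln (real d))"
    by (simp add: sum_subtractf sum_distrib_right)
  also have "(\<Sum>d | d dvd n. moebius d) * ln (real n) = 0"
    using sum_moebius_divisors[OF assms] by simp
  finally show ?thesis using 1 by simp
qed

section \<open>Character sums\<close>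

text \<open>Summation by parts: the weights \<open>f n - f (Suc n)\<close> are nonnegative and
  telescope, so together with the boundary term they add up to \<open>f M\<close>.\<close>

lemma abel_summation_bound:
  fixes f :: "nat \<Rightarrow> real" and g :: "nat \<Rightarrow> complex"
  assumes B: "\<And>N. norm (\<Sum>n=M..<N. g n) \<le> B"
    and dec: "\<And>n. n \<ge> M \<Longrightarrow> f (Suc n) \<le> f n" and nonneg: "\<And>n. n \<ge> M \<Longrightarrow> f n \<ge> 0"
  shows "norm (\<Sum>n=M..<N. of_real (f n) * g n) \<le> B * f M"
proof (cases "M \<le> N")
  case False
  have "B \<ge> 0" using order_trans[OF norm_ge_zero B] .
  thus ?thesis using False nonneg[of M] by simp
next
  case True
  define G where "G N = (\<Sum>n=M..<N. g n)" for N
  have "(\<Sum>n=M..<N. of_real (f n) * g n) =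
      of_real (f N) * G N + (\<Sum>n=M..<N. of_real (f n - f (Suc n)) * G (Suc n))"
    using True
  proof (induction N rule: dec_induct)
    case (step n)
    have "G (Suc n) = G n + g n" using step(1) by (simp add: G_def)
    thus ?case using step by (simp add: algebra_simps)
  qed (simp add: G_def)
  also have "norm \<dots> \<le> norm (of_real (f N) * G N) +
      (\<Sum>n=M..<N. norm (of_real (f n - f (Suc n)) * G (Suc n)))"
    by (rule order_trans[OF norm_triangle_ineq add_left_mono[OF norm_sum]])
  also have "\<dots> \<le> f N * B + (\<Sum>n=M..<N. (f n - f (Suc n)) * B)"
  proof (intro add_mono sum_mono)
    show "norm (of_real (f N) * G N) \<le> f N * B"
      using B[of N] nonneg[OF True] by (auto simp: norm_mult G_def intro!: mult_left_mono)
    show "norm (of_real (f n - f (Suc n)) * G (Suc n)) \<le> (f n - f (Suc n)) * B" if "n \<in> {M..<N}" for n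
    proof -
      have "norm (of_real (f n - f (Suc n)) :: complex) = f n - f (Suc n)"
        using dec[of n] that by (simp only: norm_of_real) auto
      thus ?thesis using B[of "Suc n"] dec[of n] that unfolding norm_mult G_def
        by (auto intro!: mult_left_mono)
    qed
  qed
  also have "\<dots> = B * f M"
  proof -
    have e: "(\<Sum>n=M..<N. f n - f (Suc n)) = f M - f N" using sum_Suc_diff'[OF True, of "\<lambda>n. - f n"] by simp
    show ?thesis unfolding sum_distrib_right[symmetric] e by (simp add: algebra_simps)
  qed
  finally show ?thesis .
qed

section \<open>Partial sums for \<open>L(1, \<chi>)\<close> and for its von Mangoldt
  analogue\<close>

definition char_harm :: "(nat \<Rightarrow> complex) \<Rightarrow> nat \<Rightarrow> complex" where
  "char_harm \<chi> N = (\<Sum>n=1..N. \<chi> n / n)"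

text \<open>This is \<open>L(1, \<chi>)\<close> as a limit of partial sums in their natural order;
  convergence for nonprincipal characters is \<open>char_harm_tendsto\<close>.\<close>

definition char_L1 :: "(nat \<Rightarrow> complex) \<Rightarrow> complex" where
  "char_L1 \<chi> = lim (char_harm \<chi>)"

definition char_mangoldt :: "(nat \<Rightarrow> complex) \<Rightarrow> nat \<Rightarrow> complex" where
  "char_mangoldt \<chi> N = (\<Sum>n=1..N. \<chi> n * mangoldt n / n)"

locale nonprincipal_char =
  fixes m :: nat and \<chi> :: "nat \<Rightarrow> complex"
  assumes char: "dirichlet_char m \<chi>" and m_pos: "m > 0" and nonprincipal: "\<chi> \<noteq> principal_char m"
begin

lemma norm_le: "norm (\<chi> n) \<le> 1"
  by (rule norm_dirichlet_char_le[OF char m_pos])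

lemma char_sum_bound:
  fixes f :: "nat \<Rightarrow> real"
  assumes "\<And>n. n \<ge> M \<Longrightarrow> f (Suc n) \<le> f n" "\<And>n. n \<ge> M \<Longrightarrow> f n \<ge> 0"
  shows "norm (\<Sum>n=M..<N. of_real (f n) * \<chi> n) \<le> 2 * real m * f M"
proof (rule abel_summation_bound)
  show "norm (\<Sum>n=M..<N. \<chi> n) \<le> 2 * real m" for N
    using sum_dirichlet_char_bound[OF char m_pos nonprincipal, of M N] by simp
qed (use assms in auto)

lemma char_harm_diff:
  assumes "M \<le> N"
  shows "norm (char_harm \<chi> M - char_harm \<chi> N) \<le> 2 * real m / (real M + 1)"
proof -
  have "char_harm \<chi> N = char_harm \<chi> M + (\<Sum>n=M+1..<N+1. \<chi> n / n)"
    unfolding char_harm_def using assms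
    by (subst sum.union_disjoint[symmetric]) (auto intro!: sum.cong)
  also have "(\<Sum>n=M+1..<N+1. \<chi> n / n) = (\<Sum>n=M+1..<N+1. of_real (1 / real n) * \<chi> n)"
    by (intro sum.cong) auto
  finally have "norm (char_harm \<chi> M - char_harm \<chi> N) =
      norm (\<Sum>n=M+1..<N+1. of_real (1 / real n) * \<chi> n)" by simp
  also have "\<dots> \<le> 2 * real m * (1 / real (M + 1))"
    by (rule char_sum_bound) (auto simp: field_simps)
  finally show ?thesis by (simp add: add.commute)
qed

lemma char_harm_tendsto: "char_harm \<chi> \<longlonglongrightarrow> char_L1 \<chi>"
proof -
  have "Cauchy (char_harm \<chi>)"
  proof (rule CauchyI')
    fix e :: real assume e: "e > 0"
    obtain K where K: "2 * real m / e < real K" using reals_Archimedean2 by blast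
    have "norm (char_harm \<chi> M - char_harm \<chi> N) < e" if "M \<ge> K" "N > M" for M N
    proof -
      have "2 * real m / e < real M + 1" using K that by linarith
      hence "2 * real m / (M + 1) < e" using e by (simp add: field_simps)
      thus ?thesis using char_harm_diff[of M N] that by (simp add: add.commute)
    qed
    thus "\<exists>K. \<forall>M\<ge>K. \<forall>N>M. dist (char_harm \<chi> M) (char_harm \<chi> N) < e"
      unfolding dist_norm by blast
  qed
  thus ?thesis unfolding char_L1_def by (simp add: Cauchy_convergent_iff convergent_LIMSEQ_iff)
qed

lemma char_harm_approx: "norm (char_harm \<chi> M - char_L1 \<chi>) \<le> 2 * real m / (real M + 1)"
proof (rule LIMSEQ_le_const2)
  show "(\<lambda>N. norm (char_harm \<chi> M - char_harm \<chi> N)) \<longlonglongrightarrow> norm (char_harm \<chi> M - char_L1 \<chi>)"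
    by (intro tendsto_intros char_harm_tendsto)
  show "\<exists>N. \<forall>n\<ge>N. norm (char_harm \<chi> M - char_harm \<chi> n) \<le> 2 * real m / (real M + 1)"
    by (intro exI[of _ M] allI impI char_harm_diff)
qed

text \<open>The error is stated as linear in \<open>d\<close> so that it cancels the denominator in
  weights such as \<open>mangoldt d / d\<close>, leaving a Chebyshev sum divided by
  \<open>N\<close>.\<close>

lemma char_harm_div_approx:
  assumes "d \<in> {1..N}"
  shows "norm (char_harm \<chi> (N div d) - char_L1 \<chi>) \<le> 2 * real m * d / N"
proof -
  have "N < d * (N div d + 1)"
    using assms by (metis Suc_eq_plus1 atLeastAtMost_iff dividend_less_times_div less_eq_Suc_le mult_Suc_right One_nat_def)
  hence "real N \<le> real d * (real (N div d) + 1)"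
    by (metis less_imp_le of_nat_1 of_nat_add of_nat_le_iff of_nat_mult)
  hence "2 * real m / (real (N div d) + 1) \<le> 2 * real m * d / N"
    using assms m_pos mult_left_mono[of "real N" "real d * (real (N div d) + 1)" "2 * real m"]
    by (simp add: divide_simps mult_ac)
  thus ?thesis using char_harm_approx[of "N div d"] by linarith
qed

text \<open>Complete multiplicativity splits \<open>\<chi> n / n\<close> along
  \<open>n = d * e\<close>; summing over \<open>e\<close> first produces \<open>char_harm\<close> at
  \<open>N div d\<close>.\<close>

lemma sum_char_divisor_sum:
  fixes a :: "nat \<Rightarrow> complex"
  shows "(\<Sum>n=1..N. \<chi> n / n * (\<Sum>d | d dvd n. a d)) = (\<Sum>d=1..N. \<chi> d * a d / d * char_harm \<chi> (N div d))"
proof -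
  have "(\<Sum>n=1..N. \<chi> n / n * (\<Sum>d | d dvd n. a d)) =
      (\<Sum>n=1..N. \<Sum>d | d dvd n. \<chi> d * a d / d * (\<chi> (n div d) / (n div d)))"
    unfolding sum_distrib_left
  proof (intro sum.cong refl)
    fix n d :: nat assume n: "n \<in> {1..N}" and d: "d \<in> {d. d dvd n}"
    then obtain e where e: "n = d * e" by auto
    with n have "d > 0" by (auto intro: Nat.gr0I)
    thus "\<chi> n / n * a d = \<chi> d * a d / d * (\<chi> (n div d) / (n div d))"
      using e dirichlet_charD(2)[OF char, of d e] by simp
  qed
  also have "\<dots> = (\<Sum>d=1..N. \<Sum>e=1..N div d. \<chi> d * a d / d * (\<chi> e / e))"
    by (rule sum_divisors_swap[where f = "\<lambda>d e. \<chi> d * a d / d * (\<chi> e / e)"])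
  finally show ?thesis by (simp add: char_harm_def sum_distrib_left)
qed

lemma sum_char_ln_bounded: "\<exists>C. \<forall>N. norm (\<Sum>n=1..N. \<chi> n / n * ln (real n)) \<le> C"
proof (intro exI allI)
  fix N :: nat
  let ?t = "\<lambda>n. \<chi> n / of_nat n * of_real (ln (real n))"
  \<comment> \<open>The function \<open>ln x / x\<close> decreases only from \<open>exp 1\<close>
    on, so the terms at 1 and 2 are split off before Abel summation.\<close>
  have "(\<Sum>n=1..N. ?t n) = (\<Sum>n\<in>{1..N} \<inter> {1,2}. ?t n) + (\<Sum>n=3..<N+1. ?t n)"
    by (subst sum.union_disjoint[symmetric]) (auto intro!: sum.cong)
  also have "(\<Sum>n=3..<N+1. ?t n) = (\<Sum>n=3..<N+1. of_real (ln (real n) / real n) * \<chi> n)"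
    by (intro sum.cong) auto
  also have "norm ((\<Sum>n\<in>{1..N} \<inter> {1,2}. ?t n) + \<dots>) \<le> (\<Sum>n\<in>{1,2}. norm (?t n)) + 2 * real m * (ln (real 3) / real 3)"
  proof (rule order_trans[OF norm_triangle_ineq], rule add_mono)
    have "norm (\<Sum>n\<in>{1..N} \<inter> {1,2}. ?t n) \<le> (\<Sum>n\<in>{1..N} \<inter> {1,2}. norm (?t n))" by (rule norm_sum)
    also have "\<dots> \<le> (\<Sum>n\<in>{1,2}. norm (?t n))" by (rule sum_mono2) auto
    finally show "norm (\<Sum>n\<in>{1..N} \<inter> {1,2}. ?t n) \<le> (\<Sum>n\<in>{1,2}. norm (?t n))" .
    show "norm (\<Sum>n=3..<N+1. of_real (ln (real n) / real n) * \<chi> n) \<le> 2 * real m * (ln (real 3) / real 3)"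
    proof (rule char_sum_bound)
      fix n :: nat assume n: "3 \<le> n"
      have "exp 1 \<le> (3::real)" by (rule exp_le)
      thus "ln (real (Suc n)) / real (Suc n) \<le> ln (real n) / real n"
        using n by (intro ln_x_over_x_mono) auto
      show "0 \<le> ln (real n) / real n" using n by simp
    qed
  qed
  finally show "norm (\<Sum>n=1..N. ?t n) \<le> (\<Sum>n\<in>{1,2}. norm (?t n)) + 2 * real m * (ln (real 3) / real 3)" .
qed

text \<open>Writing \<open>ln\<close> as a divisor sum of \<open>mangoldt\<close> turns a bounded
  sum into \<open>char_mangoldt \<chi> N\<close> times \<open>L(1, \<chi>)\<close> plus an error of
  norm at most \<open>16 m\<close>; a nonzero \<open>L(1, \<chi>)\<close> can be divided
  out.\<close>

lemma char_mangoldt_bounded: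
  assumes "char_L1 \<chi> \<noteq> 0"
  shows "\<exists>C. \<forall>N\<ge>1. norm (char_mangoldt \<chi> N) \<le> C"
proof -
  obtain C where C: "\<And>N. norm (\<Sum>n=1..N. \<chi> n / n * ln (real n)) \<le> C"
    using sum_char_ln_bounded by blast
  have "norm (char_mangoldt \<chi> N) \<le> (C + 16 * m) / norm (char_L1 \<chi>)" if N: "N \<ge> 1" for N
  proof -
    have "(\<Sum>n=1..N. \<chi> n / n * ln (real n)) = (\<Sum>n=1..N. \<chi> n / n * (\<Sum>d | d dvd n. mangoldt d))"
      by (intro sum.cong) (auto simp: mangoldt_sum)
    also have "\<dots> = (\<Sum>d=1..N. \<chi> d * mangoldt d / d * char_harm \<chi> (N div d))"
      by (rule sum_char_divisor_sum)
    also have "\<dots> = char_mangoldt \<chi> N * char_L1 \<chi> +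
        (\<Sum>d=1..N. \<chi> d * mangoldt d / d * (char_harm \<chi> (N div d) - char_L1 \<chi>))"
      unfolding char_mangoldt_def sum_distrib_right sum.distrib[symmetric]
      by (intro sum.cong refl) (simp add: algebra_simps diff_divide_distrib)
    finally have eq: "char_mangoldt \<chi> N * char_L1 \<chi> = (\<Sum>n=1..N. \<chi> n / n * ln (real n)) -
        (\<Sum>d=1..N. \<chi> d * mangoldt d / d * (char_harm \<chi> (N div d) - char_L1 \<chi>))" by simp
    have "norm (\<Sum>d=1..N. \<chi> d * mangoldt d / d * (char_harm \<chi> (N div d) - char_L1 \<chi>)) \<le>
        (\<Sum>d=1..N. mangoldt d * (2 * real m / N))"
    proof (rule sum_norm_le)
      fix d assume d: "d \<in> {1..N}"
      have "norm (\<chi> d * mangoldt d / d * (char_harm \<chi> (N div d) - char_L1 \<chi>)) =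
          norm (\<chi> d) * (mangoldt d / d * norm (char_harm \<chi> (N div d) - char_L1 \<chi>))"
        by (simp add: norm_mult norm_divide)
      also have "\<dots> \<le> 1 * (mangoldt d / d * (2 * real m * d / N))"
        using d by (intro mult_mono norm_le char_harm_div_approx order_refl)
          (auto simp: mangoldt_nonneg)
      also have "\<dots> = mangoldt d * (2 * real m / N)" using d by (simp add: field_simps)
      finally show "norm (\<chi> d * mangoldt d / d * (char_harm \<chi> (N div d) - char_L1 \<chi>)) \<le> mangoldt d * (2 * real m / N)" .
    qed
    also have "\<dots> = (\<Sum>d=1..N. mangoldt d) * (2 * real m / N)" by (rule sum_distrib_right[symmetric])
    also have "\<dots> \<le> 8 * N * (2 * real m / N)" using chebyshev_psi_le[of N] by (intro mult_right_mono) auto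
    also have "\<dots> = 16 * m" using N by simp
    finally have err: "norm (\<Sum>d=1..N. \<chi> d * mangoldt d / d * (char_harm \<chi> (N div d) - char_L1 \<chi>)) \<le> 16 * m" .
    have "norm (char_mangoldt \<chi> N * char_L1 \<chi>) \<le> C + 16 * m"
      unfolding eq by (rule order_trans[OF norm_triangle_ineq4 add_mono[OF C err]])
    thus ?thesis using assms by (simp add: norm_mult field_simps)
  qed
  thus ?thesis by blast
qed

text \<open>The coefficients \<open>\<mu>(d) ln (N / d)\<close> have divisor sums \<open>ln N\<close> at 1 and \<open>\<Lambda>(n)\<close> elsewhere.\<close>

lemma char_mangoldt_vanishing:
  assumes "char_L1 \<chi> = 0" "N \<ge> 1"
  shows "norm (char_mangoldt \<chi> N + ln (real N)) \<le> 2 * real m"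
proof -
  define a where "a d = complex_of_real (moebius d * (ln (real N) - ln (real d)))" for d
  have "(\<Sum>d | d dvd n. a d) = (if n = 1 then ln (real N) else 0) + mangoldt n" if "n > 0" for n
  proof -
    have "(\<Sum>d | d dvd n. a d) = of_real ((\<Sum>d | d dvd n. moebius d) * ln (real N) -
        (\<Sum>d | d dvd n. moebius d * ln (real d)))"
      unfolding a_def sum_distrib_right of_real_sum[symmetric] sum_subtractf[symmetric]
      by (simp add: algebra_simps)
    thus ?thesis
      unfolding sum_moebius_divisors[OF that] mangoldt_eq_sum_moebius[OF that] by simp
  qed
  hence "(\<Sum>n=1..N. \<chi> n / n * (\<Sum>d | d dvd n. a d)) =
      (\<Sum>n=1..N. \<chi> n / n * ((if n = 1 then ln (real N) else 0) + mangoldt n))"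
    by (intro sum.cong) auto
  also have "\<dots> = (\<Sum>n=1..N. if n = 1 then \<chi> n / n * ln (real N) else 0) + char_mangoldt \<chi> N"
    unfolding char_mangoldt_def sum.distrib[symmetric] by (intro sum.cong) (auto simp: algebra_simps)
  also have "(\<Sum>n=1..N. if n = 1 then \<chi> n / n * ln (real N) else 0) = ln (real N)"
    using assms(2) dirichlet_char_one[OF char] by simp
  finally have "char_mangoldt \<chi> N + ln (real N) = (\<Sum>d=1..N. \<chi> d * a d / d * char_harm \<chi> (N div d))"
    unfolding sum_char_divisor_sum by simp
  also have "norm \<dots> \<le> (\<Sum>d=1..N. (ln (real N) - ln (real d)) * (2 * real m / N))"
  proof (rule sum_norm_le)
    fix d assume d: "d \<in> {1..N}"
    hence ln: "ln (real d) \<le> ln (real N)" by simp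
    have "norm (\<chi> d * a d / d * char_harm \<chi> (N div d)) =
        norm (\<chi> d) * (\<bar>moebius d\<bar> * ((ln (real N) - ln (real d)) / d * norm (char_harm \<chi> (N div d) - char_L1 \<chi>)))"
      using ln by (simp add: norm_mult norm_divide a_def assms(1) abs_mult flip: of_real_mult of_real_diff)
    also have "\<dots> \<le> 1 * (1 * ((ln (real N) - ln (real d)) / d * (2 * real m * d / N)))"
      using d ln by (intro mult_mono norm_le char_harm_div_approx abs_moebius_le order_refl) auto
    also have "\<dots> = (ln (real N) - ln (real d)) * (2 * real m / N)" using d by (simp add: field_simps)
    finally show "norm (\<chi> d * a d / d * char_harm \<chi> (N div d)) \<le> (ln (real N) - ln (real d)) * (2 * real m / N)" .
  qed
  also have "\<dots> = (N * ln (real N) - (\<Sum>d=1..N. ln (real d))) * (2 * real m / N)"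
    unfolding sum_distrib_right[symmetric] by (simp add: sum_subtractf)
  \<comment> \<open>The sum of \<open>ln (N / d)\<close> over \<open>d \<le> N\<close> is
    \<open>N ln N - ln (N!)\<close>, at most \<open>N\<close> by the lower Stirling bound.\<close>
  also have "\<dots> \<le> N * (2 * real m / N)"
    using sum_ln_ge[of N] by (intro mult_right_mono) auto
  also have "\<dots> = 2 * real m" using assms(2) by simp
  finally show ?thesis .
qed

end

section \<open>Non-vanishing of L-values\<close>

lemma sum_divisors_coprime_mult:
  fixes f :: "nat \<Rightarrow> real"
  assumes mult: "\<And>a b. f (a * b) = f a * f b" and cop: "coprime a b"
  shows "(\<Sum>d | d dvd a * b. f d) = (\<Sum>d | d dvd a. f d) * (\<Sum>d | d dvd b. f d)"
proof -
  have "(\<Sum>d | d dvd a. f d) * (\<Sum>d | d dvd b. f d) =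
      (\<Sum>(x, y)\<in>{x. x dvd a} \<times> {y. y dvd b}. f (x * y))"
    unfolding sum_product sum.cartesian_product mult ..
  also have "\<dots> = (\<Sum>d | d dvd a * b. f d)"
  proof -
    have gcds: "gcd (x * y) a = x" "gcd (x * y) b = y" if "x dvd a" "y dvd b" for x y
    proof -
      have "coprime a y" using cop that(2) coprime_divisors dvd_refl by blast
      thus "gcd (x * y) a = x" using that(1) by (simp add: gcd_mult_left_right_cancel gcd_nat.absorb1)
      have "coprime b x" using cop that(1) coprime_divisors dvd_refl coprime_commute by blast
      thus "gcd (x * y) b = y" using that(2) by (simp add: gcd_mult_left_left_cancel gcd_nat.absorb1)
    qed
    show ?thesis
    proof (rule sum.reindex_bij_witness[of _ "\<lambda>d. (gcd d a, gcd d b)" "\<lambda>(x, y). x * y"], goal_cases)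
      case (3 d)
      hence "d dvd a * b" by simp
      then obtain x y where d: "d = x * y" "x dvd a" "y dvd b" using division_decomp by blast
      show ?case using gcds[OF d(2,3)] d(1) by simp
    qed (auto simp: gcds intro: mult_dvd_mono)
  qed
  finally show ?thesis ..
qed

lemma sum_divisors_prime_power:
  fixes f :: "nat \<Rightarrow> real"
  assumes mult: "\<And>a b. f (a * b) = f a * f b" and one: "f 1 = 1" and p: "prime p"
  shows "(\<Sum>d | d dvd p ^ k. f d) = (\<Sum>i\<le>k. f p ^ i)"
proof -
  have pow: "f (p ^ i) = f p ^ i" for i using one by (induction i) (simp_all add: mult)
  have "{d. d dvd p ^ k} = (\<lambda>i. p ^ i) ` {..k}"
    using p by (auto simp: divides_primepow_nat)
  moreover have "inj_on (\<lambda>i. p ^ i) {..k}"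
    using prime_gt_1_nat[OF p] by (auto intro!: inj_onI)
  ultimately show ?thesis by (simp add: sum.reindex pow)
qed

text \<open>By multiplicativity it suffices to treat prime powers. For \<open>f p\<close> equal to
  -1, 0, 1 the geometric sum up to \<open>k\<close> is alternating, constantly 1, or
  \<open>k + 1\<close>; it is nonnegative, and at least 1 for even \<open>k\<close>. The parity
  condition covers the perfect squares.\<close>

lemma divisor_sum_sign_character:
  fixes f :: "nat \<Rightarrow> real"
  assumes mult: "\<And>a b. f (a * b) = f a * f b" and one: "f 1 = 1"
    and val: "\<And>n. f n \<in> {-1, 0, 1}" and n: "n > 0"
  shows "(\<Sum>d | d dvd n. f d) \<ge> 0 \<and>
    ((\<forall>p. prime p \<longrightarrow> even (multiplicity p n)) \<longrightarrow> (\<Sum>d | d dvd n. f d) \<ge> 1)"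
  using n
proof (induction n rule: less_induct)
  case (less n)
  show ?case
  proof (cases "n = 1")
    case True
    have "{d. d dvd (1::nat)} = {1}" by auto
    thus ?thesis using True one by simp
  next
    case False
    then obtain p where p: "prime p" "p dvd n" using prime_factor_nat by blast
    define k where "k = multiplicity p n"
    obtain n' where n': "n = p ^ k * n'" "\<not> p dvd n'"
      using multiplicity_decompose'[of n p] less(2) p(1) unfolding k_def
      by (metis neq0_conv not_prime_unit)
    have k: "k > 0" using p less(2) by (simp add: k_def prime_multiplicity_gt_zero_iff)
    have n'0: "n' > 0" using n' less(2) by (auto intro: Nat.gr0I)
    have "n' < n" using n'0 k one_less_power[OF prime_gt_1_nat[OF p(1)] k] unfolding n'(1) by simp
    have cop: "coprime (p ^ k) n'" using n'(2) p(1) by (simp add: prime_imp_coprime)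
    have eq: "(\<Sum>d | d dvd n. f d) = (\<Sum>i\<le>k. f p ^ i) * (\<Sum>d | d dvd n'. f d)"
      unfolding n'(1) sum_divisors_prime_power[of f, OF mult one p(1), symmetric]
      by (intro sum_divisors_coprime_mult mult cop)
    note IH = less(1)[OF \<open>n' < n\<close> n'0]
    have geo: "(\<Sum>i\<le>k. f p ^ i) \<ge> (if even k then 1 else 0)"
    proof -
      have "(\<Sum>i\<le>k. (-1) ^ i) = (if even k then 1 else (0::real))" by (induction k) auto
      moreover have "(\<Sum>i\<le>k. 0 ^ i) = (1::real)" by (induction k) auto
      ultimately show ?thesis using val[of p] by auto
    qed
    show ?thesis
    proof (intro conjI impI)
      show "(\<Sum>d | d dvd n. f d) \<ge> 0"
        unfolding eq using geo IH by (intro mult_nonneg_nonneg) (auto split: if_splits)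
      assume ev: "\<forall>p. prime p \<longrightarrow> even (multiplicity p n)"
      hence "even k" using p(1) by (simp add: k_def)
      have "even (multiplicity q n')" if q: "prime q" for q
      proof (cases "q = p")
        case True
        thus ?thesis using n'(2) by (simp add: not_dvd_imp_multiplicity_0)
      next
        case False
        have "multiplicity q n = multiplicity q (p ^ k) + multiplicity q n'"
          unfolding n'(1) using n'0 p(1) q
          by (intro prime_elem_multiplicity_mult_distrib) auto
        also have "multiplicity q (p ^ k) = 0"
          using False p(1) q by (simp add: multiplicity_distinct_prime_power)
        finally show ?thesis using ev q by (metis add_0)
      qed
      hence "(\<Sum>d | d dvd n'. f d) \<ge> 1" using IH by blast
      thus "(\<Sum>d | d dvd n. f d) \<ge> 1"
        unfolding eq using geo \<open>even k\<close> mult_mono[of 1 "\<Sum>i\<le>k. f p ^ i" 1 "\<Sum>d | d dvd n'. f d"] by simp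
    qed
  qed
qed

text \<open>Difference between the pole \<open>1 / (n (1 - x))\<close> and the Lambert term. When
  \<open>L(1, \<chi>) = 0\<close>, the pole parts weighted by \<open>\<chi>\<close> sum to 0 in the
  limit, so these differences carry the whole Lambert series up to sign.\<close>

definition lambert_diff :: "real \<Rightarrow> nat \<Rightarrow> real" where
  "lambert_diff x n = 1 / (real n * (1 - x)) - x ^ n / (1 - x ^ n)"

section \<open>Monotonicity of the Lambert differences for fixed \<open>x\<close> between 0 and
  1\<close>

context
  fixes x :: real
  assumes x: "0 < x" "x < 1"
begin

text \<open>AM-GM for \<open>x ^ i\<close> and its mirror term \<open>x ^ (n - 1 - i)\<close>, whose
  geometric mean is \<open>sqrt x ^ (n - 1)\<close> for every \<open>i\<close>.\<close>

lemma geometric_sum_ge: "real n * sqrt x ^ (n - 1) \<le> (\<Sum>i<n. x ^ i)"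
proof -
  define y where "y = sqrt x"
  have y: "x = y ^ 2" using x by (simp add: y_def)
  have "2 * (real n * y ^ (n - 1)) = (\<Sum>i<n. 2 * y ^ (n - 1))" by simp
  also have "\<dots> \<le> (\<Sum>i<n. x ^ i + x ^ (n - Suc i))"
  proof (rule sum_mono)
    fix i assume i: "i \<in> {..<n}"
    have "0 \<le> (y ^ i - y ^ (n - Suc i)) ^ 2" by simp
    hence "2 * (y ^ i * y ^ (n - Suc i)) \<le> (y ^ i) ^ 2 + (y ^ (n - Suc i)) ^ 2"
      by (simp add: power2_diff)
    also have "y ^ i * y ^ (n - Suc i) = y ^ (n - 1)" using i by (simp flip: power_add)
    also have "(y ^ i) ^ 2 = x ^ i" by (simp add: y flip: power_mult) (simp add: mult.commute)
    also have "(y ^ (n - Suc i)) ^ 2 = x ^ (n - Suc i)" by (simp add: y flip: power_mult) (simp add: mult.commute)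
    finally show "2 * y ^ (n - 1) \<le> x ^ i + x ^ (n - Suc i)" .
  qed
  also have "\<dots> = 2 * (\<Sum>i<n. x ^ i)"
    using sum.nat_diff_reindex[of "\<lambda>i. x ^ i" n] by (simp add: sum.distrib)
  finally show ?thesis by (simp add: y_def)
qed

lemma lambert_diff_conv:
  assumes "n > 0"
  shows "lambert_diff x n = (1 / n - x ^ n / (\<Sum>i<n. x ^ i)) / (1 - x)"
proof -
  have "1 - x ^ n = (1 - x) * (\<Sum>i<n. x ^ i)" by (rule one_diff_power_eq)
  thus ?thesis
    unfolding lambert_diff_def by (simp add: diff_divide_distrib mult.commute)
qed

lemma geometric_sum_pos: "n > 0 \<Longrightarrow> (\<Sum>i<n. x ^ i) > 0"
  using x by (intro sum_pos) auto

lemma lambert_diff_nonneg: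
  assumes "n > 0"
  shows "lambert_diff x n \<ge> 0"
proof -
  have "real n * x ^ n = (\<Sum>i<n. x ^ n)" by simp
  also have "\<dots> \<le> (\<Sum>i<n. x ^ i)" using x by (intro sum_mono power_decreasing) auto
  finally have "x ^ n / (\<Sum>i<n. x ^ i) \<le> 1 / n"
    using geometric_sum_pos[OF assms] assms by (simp add: field_simps)
  thus ?thesis unfolding lambert_diff_conv[OF assms] using x by simp
qed

text \<open>After cancelling, monotonicity amounts to \<open>n (n + 1) x\<^sup>n \<le> A n * A (n + 1)\<close> for the
  geometric sums \<open>A n\<close>, which is AM-GM.\<close>

lemma lambert_diff_decreasing:
  assumes "n > 0"
  shows "lambert_diff x (Suc n) \<le> lambert_diff x n"
proof -
  define A where "A n = (\<Sum>i<n. x ^ i)" for n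
  have A: "A n > 0" "A (Suc n) > 0" unfolding A_def using assms by (intro geometric_sum_pos; simp)+
  have "A (Suc n) = 1 + x * A n"
    unfolding A_def by (subst sum.lessThan_Suc_shift) (simp add: sum_distrib_left)
  hence diff: "x ^ n / A n - x ^ Suc n / A (Suc n) = x ^ n / (A n * A (Suc n))"
    using A by (simp add: field_simps)
  have "real n * real (Suc n) * x ^ n = real n * real (Suc n) * sqrt x ^ (2 * n)"
    using x by (simp add: power_mult)
  also have "\<dots> \<le> real n * real (Suc n) * sqrt x ^ ((n - 1) + n)"
    using x by (intro mult_left_mono power_decreasing) auto
  also have "\<dots> = (real n * sqrt x ^ (n - 1)) * (real (Suc n) * sqrt x ^ (Suc n - 1))"
    by (simp add: power_add)
  also have "\<dots> \<le> A n * A (Suc n)"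
    unfolding A_def using x geometric_sum_pos[OF assms]
    by (intro mult_mono geometric_sum_ge) auto
  finally have "x ^ n / (A n * A (Suc n)) \<le> 1 / (real n * real (Suc n))"
    using A assms by (simp add: divide_simps mult_ac del: of_nat_Suc)
  also have "\<dots> = 1 / real n - 1 / real (Suc n)" using assms by (simp add: field_simps)
  finally have "1 / real (Suc n) - x ^ Suc n / A (Suc n) \<le> 1 / real n - x ^ n / A n"
    using diff by linarith
  thus ?thesis
    using x assms unfolding A_def by (simp add: lambert_diff_conv divide_right_mono del: power_Suc)
qed

lemma truncated_geometric_approx:
  assumes "d > 0" "N < d * Suc q"
  shows "\<bar>(\<Sum>e=1..q. x ^ (d * e)) - x ^ d / (1 - x ^ d)\<bar> \<le> x ^ N / (1 - x)"
proof -
  define y where "y = x ^ d"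
  have y: "0 < y" "y \<le> x" using x assms(1) power_decreasing[of 1 d x] by (auto simp: y_def)
  have "(1 - y) * (\<Sum>e=1..q. y ^ e) = y - y ^ Suc q" 
    using sum_gp_multiplied[of 1 q y] by (cases "q = 0") auto
  hence "(\<Sum>e=1..q. y ^ e) = (y - y ^ Suc q) / (1 - y)" using x y by (simp add: field_simps)
  hence "(\<Sum>e=1..q. y ^ e) - y / (1 - y) = - (y ^ Suc q / (1 - y))"
    by (simp add: diff_divide_distrib)
  hence "\<bar>(\<Sum>e=1..q. y ^ e) - y / (1 - y)\<bar> = y ^ Suc q / (1 - y)"
    using x y by simp
  also have "\<dots> \<le> x ^ N / (1 - x)"
    using x y assms(2) unfolding y_def power_mult[symmetric]
    by (intro frac_le power_decreasing) (auto simp: y_def)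
  finally show ?thesis by (simp add: y_def power_mult)
qed

end

section \<open>Non-vanishing of \<open>L(1, \<chi>)\<close> for real characters\<close>

context nonprincipal_char
begin

lemma real_char_values:
  assumes "\<And>n. cnj (\<chi> n) = \<chi> n"
  shows "of_real (Re (\<chi> n)) = \<chi> n" "Re (\<chi> n) \<in> {-1, 0, 1}"
proof -
  show *: "of_real (Re (\<chi> n)) = \<chi> n" using assms[of n] by (simp add: complex_eq_iff)
  show "Re (\<chi> n) \<in> {-1, 0, 1}"
  proof (cases "coprime n m")
    case True
    hence "\<bar>Re (\<chi> n)\<bar> = 1" using norm_dirichlet_char[OF char m_pos True] * by (metis norm_of_real)
    thus ?thesis by auto
  next
    case False
    hence "\<chi> n = 0" using dirichlet_charD(1)[OF char] by blast
    thus ?thesis by simp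
  qed
qed

text \<open>The truncated Lambert series splits into a pole part, small because
  \<open>L(1, \<chi>) = 0\<close>, an Abel-summable part bounded by
  \<open>2 m * lambert_diff x 1 = 2 m\<close>, and a truncation error. For fixed \<open>x\<close>
  the bound tends to \<open>2 m\<close> as \<open>N\<close> grows.\<close>

lemma lambert_bound:
  assumes L0: "char_L1 \<chi> = 0" and real: "\<And>n. cnj (\<chi> n) = \<chi> n" and x: "0 < x" "x < 1"
  shows "(\<Sum>n=1..N. (\<Sum>d | d dvd n. Re (\<chi> d)) * x ^ n) \<le>
    2 * real m + 2 * real m / (real N + 1) / (1 - x) + real N * x ^ N / (1 - x)"
proof -
  define c where "c n = Re (\<chi> n)" for n
  have c_abs: "\<bar>c n\<bar> \<le> 1" for n using real_char_values(2)[OF real, of n] by (auto simp: c_def)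
  have "(\<Sum>n=1..N. (\<Sum>d | d dvd n. c d) * x ^ n) = (\<Sum>n=1..N. \<Sum>d | d dvd n. c d * x ^ (d * (n div d)))"
    by (intro sum.cong refl) (auto simp: sum_distrib_right)
  also have "\<dots> = (\<Sum>d=1..N. \<Sum>e=1..N div d. c d * x ^ (d * e))"
    by (rule sum_divisors_swap[where f = "\<lambda>d e. c d * x ^ (d * e)"])
  also have "\<dots> \<le> (\<Sum>d=1..N. c d * (x ^ d / (1 - x ^ d)) + x ^ N / (1 - x))"
  proof (rule sum_mono)
    fix d assume d: "d \<in> {1..N}"
    let ?s = "(\<Sum>e=1..N div d. x ^ (d * e))" and ?t = "x ^ d / (1 - x ^ d)"
    have "N < d * Suc (N div d)" using d by (simp add: dividend_less_times_div)
    hence "\<bar>?s - ?t\<bar> \<le> x ^ N / (1 - x)"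
      using d by (intro truncated_geometric_approx x) auto
    hence "\<bar>c d\<bar> * \<bar>?s - ?t\<bar> \<le> 1 * (x ^ N / (1 - x))" by (intro mult_mono c_abs) auto
    hence "c d * (?s - ?t) \<le> x ^ N / (1 - x)" by (simp flip: abs_mult)
    thus "(\<Sum>e=1..N div d. c d * x ^ (d * e)) \<le> c d * ?t + x ^ N / (1 - x)"
      by (simp add: algebra_simps flip: sum_distrib_left)
  qed
  also have "\<dots> = (\<Sum>d=1..N. c d * (x ^ d / (1 - x ^ d))) + real N * x ^ N / (1 - x)"
    by (simp add: sum.distrib)
  also have "(\<Sum>d=1..N. c d * (x ^ d / (1 - x ^ d))) =
      (\<Sum>d=1..N. c d / d) / (1 - x) - (\<Sum>d=1..N. lambert_diff x d * c d)"
    unfolding sum_divide_distrib sum_subtractf[symmetric]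
    by (intro sum.cong refl) (simp add: lambert_diff_def algebra_simps)
  finally have eq: "(\<Sum>n=1..N. (\<Sum>d | d dvd n. c d) * x ^ n) \<le> (\<Sum>d=1..N. c d / d) / (1 - x) -
      (\<Sum>d=1..N. lambert_diff x d * c d) + real N * x ^ N / (1 - x)" .
  have "(\<Sum>d=1..N. c d / d) \<le> 2 * real m / (real N + 1)"
  proof -
    have "(\<Sum>d=1..N. c d / d) = Re (char_harm \<chi> N)" by (simp add: char_harm_def c_def)
    also have "\<dots> \<le> norm (char_harm \<chi> N)" by (rule complex_Re_le_cmod)
    finally show ?thesis using char_harm_approx[of N] L0 by simp
  qed
  hence "(\<Sum>d=1..N. c d / d) / (1 - x) \<le> 2 * real m / (real N + 1) / (1 - x)"
    using x by (intro divide_right_mono) auto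
  moreover have "- (\<Sum>d=1..N. lambert_diff x d * c d) \<le> 2 * real m"
  proof -
    have "- (\<Sum>d=1..N. lambert_diff x d * c d) = - Re (\<Sum>d=1..<Suc N. of_real (lambert_diff x d) * \<chi> d)"
      by (simp add: c_def atLeastLessThanSuc_atLeastAtMost)
    also have "\<dots> \<le> norm (\<Sum>d=1..<Suc N. of_real (lambert_diff x d) * \<chi> d)"
      by (rule abs_le_D2[OF abs_Re_le_cmod])
    also have "\<dots> \<le> 2 * real m * lambert_diff x 1"
      by (rule char_sum_bound) (auto intro!: lambert_diff_decreasing lambert_diff_nonneg x)
    also have "lambert_diff x 1 = 1" using x by (simp add: lambert_diff_def field_simps)
    finally show ?thesis by simp
  qed
  ultimately show ?thesis using eq unfolding c_def by linarith
qed

lemma char_L1_nonzero_real: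
  assumes real: "\<And>n. cnj (\<chi> n) = \<chi> n"
  shows "char_L1 \<chi> \<noteq> 0"
proof
  assume L0: "char_L1 \<chi> = 0"
  define F where "F n = (\<Sum>d | d dvd n. Re (\<chi> d))" for n
  have mult: "Re (\<chi> (a * b)) = Re (\<chi> a) * Re (\<chi> b)" for a b
    using real_char_values(1)[OF real] dirichlet_charD(2)[OF char, of a b]
    by (metis Re_complex_of_real of_real_mult)
  have F: "F n \<ge> 0 \<and> ((\<forall>p. prime p \<longrightarrow> even (multiplicity p n)) \<longrightarrow> F n \<ge> 1)" if "n > 0" for n
    unfolding F_def
    by (rule divisor_sum_sign_character[of "\<lambda>n. Re (\<chi> n)", OF mult _ real_char_values(2)[OF real] that])
       (simp add: dirichlet_char_one[OF char])
  have square: "F (k ^ 2) \<ge> 1" if "k > 0" for k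
  proof -
    have "even (multiplicity p (k ^ 2))" if "prime p" for p
      using \<open>k > 0\<close> that by (simp add: prime_elem_multiplicity_power_distrib)
    thus ?thesis using F[of "k ^ 2"] that by simp
  qed
  \<comment> \<open>The first \<open>K\<close> squares contribute at least
    \<open>K * x ^ (K ^ 2)\<close> to the Lambert series. \<open>K\<close> is chosen just above the
    limit \<open>2 m\<close> of the upper bound.\<close>
  define K where "K = 2 * m + 1"
  have main: "K * x ^ (K ^ 2) \<le> 2 * real m" if x: "0 < x" "x < 1" for x :: real
  proof (rule LIMSEQ_le_const)
    have "(\<lambda>N. 2 * real m / (real N + 1)) \<longlonglongrightarrow> 0"
      using tendsto_mult_right[OF LIMSEQ_inverse_real_of_nat, of "2 * real m"]
      by (simp add: field_simps)
    moreover have "(\<lambda>N. real N * x ^ N) \<longlonglongrightarrow> 0"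
      using powser_times_n_limit_0[of x] x by simp
    ultimately have "(\<lambda>N. 2 * real m + 2 * real m / (real N + 1) / (1 - x) + real N * x ^ N / (1 - x))
        \<longlonglongrightarrow> 2 * real m + 0 / (1 - x) + 0 / (1 - x)"
      using x by (intro tendsto_add tendsto_divide tendsto_const) auto
    thus "(\<lambda>N. 2 * real m + 2 * real m / (real N + 1) / (1 - x) + real N * x ^ N / (1 - x)) \<longlonglongrightarrow> 2 * real m"
      by simp
    have "K * x ^ (K ^ 2) \<le> 2 * real m + 2 * real m / (real N + 1) / (1 - x) + real N * x ^ N / (1 - x)"
      if N: "N \<ge> K ^ 2" for N
    proof -
      have "K * x ^ (K ^ 2) = (\<Sum>k=1..K. x ^ (K ^ 2))" by simp
      also have "\<dots> \<le> (\<Sum>k=1..K. F (k ^ 2) * x ^ (k ^ 2))"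
      proof (rule sum_mono)
        fix k assume k: "k \<in> {1..K}"
        have "x ^ (K ^ 2) \<le> x ^ (k ^ 2)" using k x by (intro power_decreasing power_mono) auto
        also have "\<dots> \<le> F (k ^ 2) * x ^ (k ^ 2)"
          using mult_right_mono[OF square[of k], of "x ^ (k ^ 2)"] k x by simp
        finally show "x ^ (K ^ 2) \<le> F (k ^ 2) * x ^ (k ^ 2)" .
      qed
      also have "\<dots> = (\<Sum>n\<in>(\<lambda>k. k ^ 2) ` {1..K}. F n * x ^ n)"
        by (subst sum.reindex) (auto intro!: inj_onI)
      also have "\<dots> \<le> (\<Sum>n=1..N. F n * x ^ n)"
      proof (rule sum_mono2)
        show "(\<lambda>k. k ^ 2) ` {1..K} \<subseteq> {1..N}"
          using N by (auto intro!: order_trans[OF power_mono N])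
        show "0 \<le> F n * x ^ n" if "n \<in> {1..N} - (\<lambda>k. k ^ 2) ` {1..K}" for n
          using F[of n] x that by (intro mult_nonneg_nonneg) auto
      qed auto
      also have "\<dots> \<le> 2 * real m + 2 * real m / (real N + 1) / (1 - x) + real N * x ^ N / (1 - x)"
        unfolding F_def by (rule lambert_bound[OF L0 real x])
      finally show ?thesis .
    qed
    thus "\<exists>N. \<forall>n\<ge>N. K * x ^ (K ^ 2) \<le> 2 * real m + 2 * real m / (real n + 1) / (1 - x) + real n * x ^ n / (1 - x)"
      by blast
  qed
  \<comment> \<open>Letting \<open>x\<close> tend to 1 in \<open>main\<close>, along
    \<open>1 - 1 / (j + 2)\<close>, gives \<open>K \<le> 2 m\<close>.\<close>
  have "(\<lambda>j. 1 - inverse (real (Suc (Suc j)))) \<longlonglongrightarrow> 1 - 0"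
    by (intro tendsto_diff tendsto_const LIMSEQ_Suc[OF LIMSEQ_inverse_real_of_nat])
  hence "(\<lambda>j. real K * (1 - inverse (real (Suc (Suc j)))) ^ (K ^ 2)) \<longlonglongrightarrow> real K * (1 - 0) ^ (K ^ 2)"
    by (intro tendsto_mult tendsto_const tendsto_power)
  moreover have "real K * (1 - inverse (real (Suc (Suc j)))) ^ (K ^ 2) \<le> 2 * real m" for j
    by (rule main) (auto simp: field_simps)
  ultimately have "real K * (1 - 0) ^ (K ^ 2) \<le> 2 * real m"
    by (intro LIMSEQ_le_const2) auto
  thus False by (simp add: K_def)
qed

lemma nonprincipal_char_cnj: "nonprincipal_char m (\<lambda>n. cnj (\<chi> n))"
proof
  show "dirichlet_char m (\<lambda>n. cnj (\<chi> n))" by (rule dirichlet_char_cnj[OF char])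
  show "(\<lambda>n. cnj (\<chi> n)) \<noteq> principal_char m"
  proof
    assume eq: "(\<lambda>n. cnj (\<chi> n)) = principal_char m"
    have "\<chi> n = principal_char m n" for n
      using arg_cong[OF fun_cong[OF eq, of n], of cnj] by (simp add: principal_char_def split: if_splits)
    thus False using nonprincipal by blast
  qed
qed (rule m_pos)

lemma char_L1_cnj: "char_L1 (\<lambda>n. cnj (\<chi> n)) = cnj (char_L1 \<chi>)"
proof -
  have "char_harm (\<lambda>n. cnj (\<chi> n)) = (\<lambda>N. cnj (char_harm \<chi> N))"
    by (simp add: char_harm_def fun_eq_iff)
  moreover have "(\<lambda>N. cnj (char_harm \<chi> N)) \<longlonglongrightarrow> cnj (char_L1 \<chi>)"
    by (intro tendsto_cnj char_harm_tendsto)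
  ultimately show ?thesis unfolding char_L1_def[of "\<lambda>n. cnj (\<chi> n)"] by (simp add: limI)
qed

text \<open>Used before non-vanishing is known for all characters: if
  \<open>L(1, \<chi>) = 0\<close>, the sum behaves like \<open>- ln N\<close>, so an upper bound
  holds in either case.\<close>

lemma Re_char_mangoldt_bounded: "\<exists>C. \<forall>N\<ge>1. Re (char_mangoldt \<chi> N) \<le> C"
proof (cases "char_L1 \<chi> = 0")
  case False
  then obtain C where "\<And>N. N \<ge> 1 \<Longrightarrow> norm (char_mangoldt \<chi> N) \<le> C"
    using char_mangoldt_bounded by blast
  thus ?thesis using complex_Re_le_cmod order_trans by blast
next
  case True
  have "Re (char_mangoldt \<chi> N) \<le> 2 * m" if N: "N \<ge> 1" for N
  proof -
    have "Re (char_mangoldt \<chi> N) + ln (real N) \<le> 2 * m"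
      using complex_Re_le_cmod[of "char_mangoldt \<chi> N + ln (real N)"]
        char_mangoldt_vanishing[OF True N] by simp
    moreover have "0 \<le> ln (real N)" using N by simp
    ultimately show ?thesis by linarith
  qed
  thus ?thesis by blast
qed

end

section \<open>Sums over all characters and the non-vanishing for complex ones\<close>

lemma sum_char_mangoldt:
  assumes "m > 0" "coprime a m"
  shows "(\<Sum>\<chi> | dirichlet_char m \<chi>. cnj (\<chi> a) * char_mangoldt \<chi> N) =
    of_real (card {\<chi>. dirichlet_char m \<chi>} * (\<Sum>n | n \<in> {1..N} \<and> [n = a] (mod m). mangoldt n / n))"
proof -
  let ?X = "{\<chi>. dirichlet_char m \<chi>}"
  have "(\<Sum>\<chi>\<in>?X. cnj (\<chi> a) * char_mangoldt \<chi> N) =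
      (\<Sum>n=1..N. (\<Sum>\<chi>\<in>?X. cnj (\<chi> a) * \<chi> n) * (mangoldt n / n))"
    unfolding char_mangoldt_def sum_distrib_left sum_distrib_right
    by (subst sum.swap) (simp add: mult_ac)
  also have "\<dots> = (\<Sum>n=1..N. if [n = a] (mod m) then of_real (card ?X * (mangoldt n / n)) else 0)"
    unfolding dirichlet_chars_orthogonality[OF assms] by (intro sum.cong) auto
  also have "\<dots> = (\<Sum>n | n \<in> {1..N} \<and> [n = a] (mod m). of_real (card ?X * (mangoldt n / n)))"
    by (simp add: sum.If_cases Int_def)
  finally show ?thesis by (simp add: sum_distrib_left)
qed

lemma Re_char_mangoldt_principal:
  "Re (char_mangoldt (principal_char m) N) = (\<Sum>n | n \<in> {1..N} \<and> coprime n m. mangoldt n / n)"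
proof -
  have "Re (char_mangoldt (principal_char m) N) = (\<Sum>n=1..N. if coprime n m then mangoldt n / n else 0)"
    unfolding char_mangoldt_def Re_sum
    by (intro sum.cong) (auto simp: principal_char_def)
  thus ?thesis by (simp add: sum.If_cases Int_def)
qed

theorem (in nonprincipal_char) char_L1_nonzero: "char_L1 \<chi> \<noteq> 0"
proof
  assume L0: "char_L1 \<chi> = 0"
  define \<psi> where "\<psi> = (\<lambda>n. cnj (\<chi> n))"
  have "\<psi> \<noteq> \<chi>" using char_L1_nonzero_real L0 unfolding \<psi>_def by (metis (no_types))
  interpret \<psi>: nonprincipal_char m \<psi> unfolding \<psi>_def by (rule nonprincipal_char_cnj)
  have L0': "char_L1 \<psi> = 0" unfolding \<psi>_def char_L1_cnj L0 by simp
  let ?X = "{\<chi>. dirichlet_char m \<chi>}" and ?p = "principal_char m"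
  let ?Y = "?X - {\<chi>, \<psi>, ?p}"
  have fin: "finite ?X" by (rule finite_dirichlet_chars[OF m_pos])
  have "\<exists>C. \<forall>N\<ge>1. Re (char_mangoldt \<phi> N) \<le> C" if "\<phi> \<in> ?Y" for \<phi>
    using that by (intro nonprincipal_char.Re_char_mangoldt_bounded[of m]) (auto simp: nonprincipal_char_def m_pos)
  then obtain C where C: "\<And>\<phi> N. \<phi> \<in> ?Y \<Longrightarrow> N \<ge> 1 \<Longrightarrow> Re (char_mangoldt \<phi> N) \<le> C \<phi>" by metis
  have bound: "ln (real N) \<le> 8 + 4 * real m + (\<Sum>\<phi>\<in>?Y. C \<phi>)" if N: "N \<ge> 1" for N
  proof -
    \<comment> \<open>The class of 1 gives every character the weight 1. The total is nonnegative,
      yet \<open>\<chi>\<close> and \<open>\<psi>\<close> contribute \<open>- 2 ln N\<close> against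
      only \<open>ln N\<close> from the principal character.\<close>
    have "0 \<le> card ?X * (\<Sum>n | n \<in> {1..N} \<and> [n = 1] (mod m). mangoldt n / n :: real)"
      by (intro mult_nonneg_nonneg sum_nonneg) (auto simp: mangoldt_nonneg)
    also have "\<dots> = Re (\<Sum>\<phi>\<in>?X. cnj (\<phi> 1) * char_mangoldt \<phi> N)"
      by (subst sum_char_mangoldt[OF m_pos]) auto
    also have "\<dots> = (\<Sum>\<phi>\<in>?X. Re (char_mangoldt \<phi> N))"
      by (simp add: dirichlet_char_one)
    also have "?X = insert \<chi> (insert \<psi> (insert ?p ?Y))"
      using char \<psi>.char dirichlet_char_principal[OF m_pos] by auto
    also have "(\<Sum>\<phi>\<in>\<dots>. Re (char_mangoldt \<phi> N)) = Re (char_mangoldt \<chi> N) + Re (char_mangoldt \<psi> N) +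
        Re (char_mangoldt ?p N) + (\<Sum>\<phi>\<in>?Y. Re (char_mangoldt \<phi> N))"
      using fin \<open>\<psi> \<noteq> \<chi>\<close> nonprincipal \<psi>.nonprincipal by (subst sum.insert; auto)+
    also have "\<dots> \<le> (2 * m - ln (real N)) + (2 * m - ln (real N)) + (ln (real N) + 8) + (\<Sum>\<phi>\<in>?Y. C \<phi>)"
    proof (intro add_mono sum_mono C N)
      show "Re (char_mangoldt \<chi> N) \<le> 2 * m - ln (real N)"
        using complex_Re_le_cmod[of "char_mangoldt \<chi> N + ln (real N)"]
          char_mangoldt_vanishing[OF L0 N] by simp
      show "Re (char_mangoldt \<psi> N) \<le> 2 * m - ln (real N)"
        using complex_Re_le_cmod[of "char_mangoldt \<psi> N + ln (real N)"]
          \<psi>.char_mangoldt_vanishing[OF L0' N] by simp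
      have "Re (char_mangoldt ?p N) \<le> (\<Sum>n=1..N. mangoldt n / n)"
        unfolding Re_char_mangoldt_principal by (rule sum_mono2) (auto simp: mangoldt_nonneg)
      also have "\<dots> \<le> ln (real N) + 8" using N by (intro mertens_upper) auto
      finally show "Re (char_mangoldt ?p N) \<le> ln (real N) + 8" .
    qed auto
    finally show ?thesis by simp
  qed
  obtain N where N: "exp (8 + 4 * real m + (\<Sum>\<phi>\<in>?Y. C \<phi>)) < real N" using reals_Archimedean2 by blast
  hence "N \<ge> 1" using exp_gt_zero[of "8 + 4 * real m + (\<Sum>\<phi>\<in>?Y. C \<phi>)"] by linarith
  have "8 + 4 * real m + (\<Sum>\<phi>\<in>?Y. C \<phi>) < ln (real N)"
    using N \<open>N \<ge> 1\<close> by (metis exp_less_cancel_iff exp_ln of_nat_0_less_iff less_le_trans zero_less_one)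
  thus False using bound[OF \<open>N \<ge> 1\<close>] by simp
qed

section \<open>Primes in arithmetic progressions\<close>

text \<open>If the primes in the class were finite in number, the von Mangoldt sum over the class
  would be bounded. Orthogonality and the bounded nonprincipal sums would then bound the principal
  one, contradicting \<open>mertens_lower\<close>.\<close>

theorem dirichlet_primes:
  fixes a m :: nat
  assumes m: "m > 0" and a: "coprime a m"
  shows "infinite {p. prime p \<and> [p = a] (mod m)}"
proof
  let ?P = "{p. prime p \<and> [p = a] (mod m)}"
  assume finP: "finite ?P"
  let ?X = "{\<chi>. dirichlet_char m \<chi>}" and ?p = "principal_char m"
  have fin: "finite ?X" by (rule finite_dirichlet_chars[OF m])
  have "\<exists>C. \<forall>N\<ge>1. norm (char_mangoldt \<phi> N) \<le> C" if "\<phi> \<in> ?X - {?p}" for \<phi>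
  proof -
    interpret nonprincipal_char m \<phi> using that m by unfold_locales auto
    show ?thesis by (rule char_mangoldt_bounded[OF char_L1_nonzero])
  qed
  then obtain C where C: "\<And>\<phi> N. \<phi> \<in> ?X - {?p} \<Longrightarrow> N \<ge> 1 \<Longrightarrow> norm (char_mangoldt \<phi> N) \<le> C \<phi>"
    by metis
  define B1 where "B1 = (\<Sum>p\<in>?P. mangoldt p / p) + (4::real)"
  define B2 where "B2 = (\<Sum>p | p dvd m. mangoldt p / p) + (4::real)"
  have bound: "ln (real N) \<le> card ?X * B1 + (\<Sum>\<phi>\<in>?X - {?p}. C \<phi>) + B2 + 1" if N: "N \<ge> 1" for N
  proof -
    let ?NP = "{n. n \<in> {1..N} \<and> \<not> prime n}"
    \<comment> \<open>Primes are confined to a finite set and nonprimes cost at most 4. This serves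
      both the class of \<open>a\<close> (\<open>B1\<close>) and the integers not coprime to
      \<open>m\<close> (\<open>B2\<close>).\<close>
    have split: "(\<Sum>n\<in>A. mangoldt n / n) \<le> (\<Sum>p\<in>Q. mangoldt p / p) + (4::real)"
      if "A \<subseteq> Q \<union> ?NP" "finite Q" for A Q
    proof -
      have "(\<Sum>n\<in>A. mangoldt n / n) \<le> (\<Sum>n\<in>Q \<union> ?NP. mangoldt n / n :: real)"
        using that by (intro sum_mono2) (auto simp: mangoldt_nonneg)
      also have "\<dots> \<le> (\<Sum>p\<in>Q. mangoldt p / p) + (\<Sum>n\<in>?NP. mangoldt n / n :: real)"
        using that sum.union_inter[of Q ?NP "\<lambda>n. mangoldt n / real n"]
          sum_nonneg[of "Q \<inter> ?NP" "\<lambda>n. mangoldt n / real n"] by (simp add: mangoldt_nonneg)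
      finally show ?thesis using sum_mangoldt_nonprime_le[of N] by linarith
    qed
    have "ln (real N) - 1 \<le> (\<Sum>n=1..N. mangoldt n / n)" using N by (intro mertens_lower) auto
    also have "\<dots> = Re (char_mangoldt ?p N) + (\<Sum>n | n \<in> {1..N} \<and> \<not> coprime n m. mangoldt n / n)"
      unfolding Re_char_mangoldt_principal
      by (subst sum.union_disjoint[symmetric]) (auto intro!: sum.cong)
    also have "(\<Sum>n | n \<in> {1..N} \<and> \<not> coprime n m. mangoldt n / n) \<le> B2"
      unfolding B2_def using m
      by (intro split) (auto simp: prime_imp_coprime_nat intro: finite_divisors_nat)
    also have "Re (char_mangoldt ?p N) \<le> card ?X * B1 + (\<Sum>\<phi>\<in>?X - {?p}. C \<phi>)"
    proof -
      have "(\<Sum>\<phi>\<in>?X. cnj (\<phi> a) * char_mangoldt \<phi> N) =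
          cnj (?p a) * char_mangoldt ?p N + (\<Sum>\<phi>\<in>?X - {?p}. cnj (\<phi> a) * char_mangoldt \<phi> N)"
        by (rule sum.remove[OF fin]) (simp add: dirichlet_char_principal m)
      hence "char_mangoldt ?p N = (\<Sum>\<phi>\<in>?X. cnj (\<phi> a) * char_mangoldt \<phi> N) -
          (\<Sum>\<phi>\<in>?X - {?p}. cnj (\<phi> a) * char_mangoldt \<phi> N)" using a by (simp add: principal_char_def)
      hence "Re (char_mangoldt ?p N) =
          card ?X * (\<Sum>n | n \<in> {1..N} \<and> [n = a] (mod m). mangoldt n / n) -
          Re (\<Sum>\<phi>\<in>?X - {?p}. cnj (\<phi> a) * char_mangoldt \<phi> N)"
        unfolding sum_char_mangoldt[OF m a] by simp
      moreover have "card ?X * (\<Sum>n | n \<in> {1..N} \<and> [n = a] (mod m). mangoldt n / n) \<le> card ?X * B1"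
        unfolding B1_def by (intro mult_left_mono split finP) auto
      moreover have "- Re (\<Sum>\<phi>\<in>?X - {?p}. cnj (\<phi> a) * char_mangoldt \<phi> N) \<le> (\<Sum>\<phi>\<in>?X - {?p}. C \<phi>)"
      proof -
        have "- Re (\<Sum>\<phi>\<in>?X - {?p}. cnj (\<phi> a) * char_mangoldt \<phi> N) \<le>
            norm (\<Sum>\<phi>\<in>?X - {?p}. cnj (\<phi> a) * char_mangoldt \<phi> N)"
          by (rule abs_le_D2[OF abs_Re_le_cmod])
        also have "\<dots> \<le> (\<Sum>\<phi>\<in>?X - {?p}. C \<phi>)"
        proof (rule sum_norm_le)
          fix \<phi> assume \<phi>: "\<phi> \<in> ?X - {?p}"
          show "norm (cnj (\<phi> a) * char_mangoldt \<phi> N) \<le> C \<phi>"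
            using C[OF \<phi> N] norm_dirichlet_char[OF _ m a, of \<phi>] \<phi> by (simp add: norm_mult)
        qed
        finally show ?thesis .
      qed
      ultimately show ?thesis by linarith
    qed
    finally show ?thesis by simp
  qed
  define K where "K = card ?X * B1 + (\<Sum>\<phi>\<in>?X - {?p}. C \<phi>) + B2 + 1"
  obtain N where N: "exp K < real N" using reals_Archimedean2 by blast
  hence "N \<ge> 1" using exp_gt_zero[of K] by linarith
  have "K < ln (real N)"
    using N \<open>N \<ge> 1\<close> by (metis exp_less_cancel_iff exp_ln of_nat_0_less_iff less_le_trans zero_less_one)
  thus False using bound[OF \<open>N \<ge> 1\<close>] by (simp add: K_def)
qed

section \<open>Progressions without integers of the form p + 2^k\<close>

definition odd_prime_divisors :: "nat \<Rightarrow> nat set" where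
  "odd_prime_divisors m = {q. prime q \<and> odd q \<and> q dvd m}"

definition odd_radical :: "nat \<Rightarrow> nat" where
  "odd_radical m = \<Prod>(odd_prime_divisors m)"

lemma finite_odd_prime_divisors: "m > 0 \<Longrightarrow> finite (odd_prime_divisors m)"
  by (rule finite_subset[OF _ finite_divisors_nat[of m]]) (auto simp: odd_prime_divisors_def)

lemma odd_prime_divisors_le: "m > 0 \<Longrightarrow> q \<in> odd_prime_divisors m \<Longrightarrow> q \<le> m"
  by (auto simp: odd_prime_divisors_def intro: dvd_imp_le)

lemma dvd_odd_radical: "m > 0 \<Longrightarrow> q \<in> odd_prime_divisors m \<Longrightarrow> q dvd odd_radical m"
  unfolding odd_radical_def by (intro dvd_prodI finite_odd_prime_divisors)

lemma odd_odd_radical: "m > 0 \<Longrightarrow> odd (odd_radical m)"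
  unfolding odd_radical_def
  by (subst even_prod_iff) (auto simp: finite_odd_prime_divisors odd_prime_divisors_def)

lemma squarefree_odd_radical: "squarefree (odd_radical m)"
  unfolding odd_radical_def
  by (rule squarefree_prod_coprime)
     (auto simp: odd_prime_divisors_def squarefree_prime primes_coprime)

lemma U_setD: "n \<in> U_set \<Longrightarrow> prime p \<Longrightarrow> k > 0 \<Longrightarrow> n \<noteq> p + 2 ^ k"
  unfolding U_set_def by blast

lemma cong_add_dvd_left:
  fixes x y q :: nat
  shows "q dvd x \<Longrightarrow> [x + y = y] (mod q)"
  by (auto simp: cong_def)

lemma progression_covering:
  assumes I: "(m, b) \<in> prog_I" and n: "n \<in> arith_prog m b" and k: "k > 0"
  obtains q where "q \<in> odd_prime_divisors m" "[n = 2 ^ k] (mod q)"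
proof -
  have m: "m > 0" and U: "arith_prog m b \<subseteq> U_set" and odd_el: "\<And>n. n \<in> arith_prog m b \<Longrightarrow> odd n"
    using I by (auto simp: prog_I_def)
  have "m * 0 + b \<in> arith_prog m b" "m * 1 + b \<in> arith_prog m b" unfolding arith_prog_def by blast+
  \<comment> \<open>Two consecutive odd terms force an even difference, which makes \<open>a\<close>
    below odd and hence any prime divisor of it odd.\<close>
  hence "odd b" "odd (m + b)" using odd_el by fastforce+
  hence m_even: "even m" by simp
  \<comment> \<open>\<open>a\<close> represents \<open>n - 2 ^ k\<close> modulo \<open>m\<close>
    without a subtraction that could be truncated at 0.\<close>
  define a where "a = n + (m - 1) * 2 ^ k"
  have a_eq: "a + 2 ^ k = n + m * 2 ^ k" using m by (cases m) (auto simp: a_def)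
  have "odd n" using odd_el n by blast
  hence "odd a" using a_eq k m_even by (metis even_add even_mult_iff even_power even_numeral)
  show ?thesis
  proof (cases "coprime a m")
    case True
    \<comment> \<open>A prime above \<open>b\<close> ensures that \<open>p + 2 ^ k\<close>, being
      congruent to \<open>b\<close>, is a term of the progression rather than an integer below its
      first term.\<close>
    obtain p where p: "prime p" "[p = a] (mod m)" "p > b"
      using dirichlet_primes[OF m True] unfolding infinite_nat_iff_unbounded by auto
    obtain h where h: "n = m * h + b" using n by (auto simp: arith_prog_def)
    have "[p + 2 ^ k = a + 2 ^ k] (mod m)" using p(2) by (simp add: cong_add_rcancel_nat)
    moreover have "[a + 2 ^ k = b] (mod m)" unfolding a_eq h by (simp add: cong_def)
    ultimately have "[p + 2 ^ k = b] (mod m)" by (rule cong_trans)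
    hence "m dvd p + 2 ^ k - b" using p(3) by (subst cong_altdef_nat[symmetric]) auto
    then obtain t where "p + 2 ^ k - b = m * t" by auto
    hence "p + 2 ^ k = m * t + b" using p(3) by simp
    hence "p + 2 ^ k \<in> U_set" using U unfolding arith_prog_def by blast
    thus ?thesis using U_setD[OF _ p(1) k] by blast
  next
    case False
    hence "gcd a m \<noteq> 1" using coprime_iff_gcd_eq_1 by blast
    then obtain q where "prime q" "q dvd gcd a m" using prime_factor_nat by blast
    hence q: "prime q" "q dvd a" "q dvd m" by auto
    have "odd q" using q(2) \<open>odd a\<close> dvd_trans by blast
    have "[m * 2 ^ k + n = n] (mod q)" using q(3) by (intro cong_add_dvd_left) auto
    hence "[n = a + 2 ^ k] (mod q)" unfolding a_eq by (simp add: cong_sym_eq add.commute)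
    moreover have "[a + 2 ^ k = 2 ^ k] (mod q)" using q(2) by (rule cong_add_dvd_left)
    ultimately have "[n = 2 ^ k] (mod q)" by (rule cong_trans)
    thus ?thesis using that q \<open>odd q\<close> by (auto simp: odd_prime_divisors_def)
  qed
qed

text \<open>The covering of \<open>n - 2 ^ k\<close> by primes \<open>q\<close> depends only on
  \<open>n\<close> modulo the odd radical, so it persists for \<open>D * h + n\<close>. A prime
  \<open>p\<close> in a representation must then equal such a \<open>q\<close>, which is what
  \<open>exc\<close> rules out.\<close>

lemma progression_through_element:
  assumes I: "(m, b) \<in> prog_I" and n: "n \<in> arith_prog m b"
    and D: "even D" "D > 0" "odd_radical m dvd D"
    and exc: "\<And>h q k. q \<in> odd_prime_divisors m \<Longrightarrow> k > 0 \<Longrightarrow> D * h + n \<noteq> q + 2 ^ k"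
  shows "(D, n) \<in> prog_I"
proof -
  have m: "m > 0" and odd: "odd n" and pos: "n > 0" using I n by (auto simp: prog_I_def)
  have "D * h + n \<in> U_set" for h
  proof -
    have False if p: "prime p" "k > 0" "D * h + n = p + 2 ^ k" for p k
    proof -
      obtain q where q: "q \<in> odd_prime_divisors m" "[n = 2 ^ k] (mod q)"
        using progression_covering[OF I n p(2)] by blast
      have "q dvd D" using dvd_odd_radical[OF m q(1)] D(3) by (rule dvd_trans)
      hence "[D * h + n = n] (mod q)" by (intro cong_add_dvd_left) auto
      hence "[p + 2 ^ k = 0 + 2 ^ k] (mod q)" using q(2) p(3) by (metis add_0 cong_trans)
      hence "q dvd p" by (simp only: cong_add_rcancel_nat cong_0_iff)
      hence "q = p" using q(1) p(1) primes_dvd_imp_eq by (auto simp: odd_prime_divisors_def)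
      thus False using exc[OF q(1) p(2)] p(3) by blast
    qed
    thus ?thesis using odd D(1) unfolding U_set_def by auto
  qed
  thus ?thesis using D odd pos unfolding prog_I_def arith_prog_def by auto
qed

section \<open>Construction of the differences \<open>2 ^ K * R\<close> and
  \<open>2 * R * M\<close>\<close>

lemma first_term_in_arith_prog: "n \<in> arith_prog D n"
  unfolding arith_prog_def by (auto intro: exI[of _ 0])

text \<open>A power of 2 exceeding \<open>n + m\<close> separates two cases: a large
  \<open>k\<close> is invisible modulo \<open>2 ^ K\<close> and would force \<open>n = q\<close>,
  while a small \<open>k\<close> leaves room only for \<open>h = 0\<close>.\<close>

lemma exists_prog_J:
  assumes I: "(m, b) \<in> prog_I" and n: "n \<in> arith_prog m b"
  obtains D where "(D, n) \<in> prog_J"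
proof -
  have m: "m > 0" and pos: "n > 0" and U: "n \<in> U_set" using I n by (auto simp: prog_I_def)
  define K where "K = Suc (n + m)"
  define R where "R = odd_radical m"
  have R: "odd R" "R > 0" using odd_odd_radical[OF m] by (auto simp: R_def intro: odd_pos)
  have K: "n + m < 2 ^ K" unfolding K_def by (rule less_trans[OF less_exp]) simp
  have exc: "2 ^ K * R * h + n \<noteq> q + 2 ^ k" if q: "q \<in> odd_prime_divisors m" and k: "k > 0" for h q k
  proof
    assume eq: "2 ^ K * R * h + n = q + 2 ^ k"
    have qm: "q \<le> m" by (rule odd_prime_divisors_le[OF m q])
    have qR: "q dvd R" unfolding R_def by (rule dvd_odd_radical[OF m q])
    show False
    proof (cases "K \<le> k")
      case True
      have "(2 ^ K * R * h + n) mod 2 ^ K = n" using K by (simp add: mult.assoc)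
      moreover have "(q + 2 ^ k) mod 2 ^ K = q"
        using True K qm by (subst mod_add_right_eq[symmetric]) (simp add: le_imp_power_dvd)
      ultimately have "n = q" using eq by simp
      \<comment> \<open>The odd prime \<open>q\<close> divides \<open>R\<close> and would thus
        divide a power of 2.\<close>
      hence "2 ^ K * R * h = 2 ^ k" using eq by simp
      hence "q dvd 2 ^ k" using qR by (metis dvd_mult dvd_mult2)
      hence "q dvd 2" using q prime_dvd_power unfolding odd_prime_divisors_def by blast
      hence "q = 2" using q primes_dvd_imp_eq two_is_prime_nat unfolding odd_prime_divisors_def by blast
      thus False using q by (simp add: odd_prime_divisors_def)
    next
      case False
      hence "(2::nat) ^ k \<le> 2 ^ (n + m)" by (intro power_increasing) (auto simp: K_def)
      moreover have "q \<le> R" using qR R by (intro dvd_imp_le) auto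
      \<comment> \<open>Since \<open>K = n + m + 1\<close>, one half of \<open>2 ^ K * R\<close>
        absorbs \<open>q\<close> and the other half absorbs \<open>2 ^ k\<close>.\<close>
      moreover have "2 ^ K * R = 2 ^ (n + m) * R + 2 ^ (n + m) * R" by (simp add: K_def)
      moreover have "R \<le> 2 ^ (n + m) * R" "2 ^ (n + m) \<le> 2 ^ (n + m) * R" using R by auto
      ultimately have small: "q + 2 ^ k \<le> 2 ^ K * R" by linarith
      show False
      proof (cases "h = 0")
        case True
        thus False using eq U_setD[OF U _ k, of q] q by (simp add: odd_prime_divisors_def)
      next
        case False
        hence "2 ^ K * R \<le> 2 ^ K * R * h" by simp
        thus False using small eq pos by linarith
      qed
    qed
  qed
  have "(2 ^ K * R, n) \<in> prog_I"
    by (rule progression_through_element[OF I n _ _ _ exc]) (use R in \<open>auto simp: K_def R_def\<close>)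
  thus ?thesis
    using that R squarefree_odd_radical[of m] unfolding prog_J_def R_def by blast
qed

text \<open>Modulo a Mersenne prime \<open>2^r - 1\<close> the powers of two are exactly \<open>2^j\<close> with \<open>j < r\<close>, so a
  representation \<open>q + 2^k\<close> of an element of the progression descends to one of \<open>n\<close> itself.\<close>

lemma exists_prog_K:
  assumes I: "(m, b) \<in> prog_I" and n: "n \<in> arith_prog m b" and inf: "infinite {p. mersenne_prime p}"
  obtains D where "(D, n) \<in> prog_K"
proof -
  have m: "m > 0" and U: "n \<in> U_set" using I n by (auto simp: prog_I_def)
  hence odd: "odd n" by (simp add: U_set_def)
  define R where "R = odd_radical m"
  have R: "odd R" "R > 0" using odd_odd_radical[OF m] by (auto simp: R_def intro: odd_pos)
  \<comment> \<open>The size of \<open>M\<close> gives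
    \<open>q + 2 ^ j \<le> m + (M + 1) / 2 < M\<close> and \<open>n < M\<close>, so a congruence
    modulo \<open>M\<close> becomes an equality. It also keeps \<open>M\<close> distinct from 2 and
    from the primes in \<open>R\<close>.\<close>
  obtain M where M: "mersenne_prime M" "M > n + 2 * m + 2"
    using inf unfolding infinite_nat_iff_unbounded by blast
  then obtain r where r: "prime M" "M = 2 ^ r - 1" by (auto simp: mersenne_prime_def)
  have "r \<noteq> 0" using M(2) r(2) by (intro notI) simp
  hence M2: "2 ^ r = M + 1" "2 ^ r = 2 * (2 ^ (r - 1) :: nat)"
    using r(2) by (auto simp flip: power_Suc)
  have exc: "2 * R * M * h + n \<noteq> q + 2 ^ k" if q: "q \<in> odd_prime_divisors m" and k: "k > 0" for h q k
  proof
    assume eq: "2 * R * M * h + n = q + 2 ^ k"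
    define j where "j = k mod r"
    have "j < r" using \<open>r \<noteq> 0\<close> by (simp add: j_def)
    have "[(2::nat) ^ r = 1] (mod M)" unfolding M2(1) by (rule cong_add_dvd_left) simp
    hence "[(2 ^ r) ^ (k div r) * 2 ^ j = 1 ^ (k div r) * (2::nat) ^ j] (mod M)"
      by (intro cong_mult cong_pow cong_refl)
    hence "[(2::nat) ^ k = 2 ^ j] (mod M)"
      by (simp add: j_def flip: power_mult power_add)
    hence "[q + 2 ^ k = q + 2 ^ j] (mod M)" by (intro cong_add cong_refl)
    moreover have "[n = 2 * R * M * h + n] (mod M)" by (rule cong_sym, rule cong_add_dvd_left) simp
    ultimately have c: "[n = q + 2 ^ j] (mod M)" unfolding eq by (rule cong_trans[rotated])
    have "(2::nat) ^ j \<le> 2 ^ (r - 1)" using \<open>j < r\<close> by (intro power_increasing) auto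
    hence "q + 2 ^ j < M" using M2 M(2) odd_prime_divisors_le[OF m q] by linarith
    hence nq: "n = q + 2 ^ j" using c M(2) by (auto simp: cong_def)
    \<comment> \<open>The residue \<open>j = 0\<close> must be excluded because \<open>U_set\<close>
      only forbids positive exponents; it would make \<open>n = q + 1\<close> even.\<close>
    have "j > 0" using nq odd q by (auto intro!: Nat.gr0I simp: odd_prime_divisors_def)
    thus False using nq U_setD[OF U, of q j] q by (simp add: odd_prime_divisors_def)
  qed
  have I': "(2 * R * M, n) \<in> prog_I"
    by (rule progression_through_element[OF I n _ _ _ exc])
       (use R r(1) in \<open>auto simp: R_def prime_gt_0_nat\<close>)
  have "M \<noteq> q" if "q \<in> odd_prime_divisors m" for q
    using odd_prime_divisors_le[OF m that] M(2) by linarith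
  hence "coprime (odd_radical m) M"
    unfolding odd_radical_def using r(1)
    by (intro prod_coprime_left primes_coprime) (auto simp: odd_prime_divisors_def)
  moreover have "coprime 2 M" using r(1) M(2) by (intro primes_coprime) auto
  moreover have "coprime 2 R" using R(1) by simp
  ultimately have "squarefree (2 * R * M)"
    using squarefree_odd_radical[of m] r(1) unfolding R_def
    by (intro squarefree_mult_coprime) (auto simp: squarefree_prime)
  thus ?thesis using that I' unfolding prog_K_def by blast
qed

theorem theorem5:
  shows "(\<Union>(m, b) \<in> prog_I. arith_prog m b) = (\<Union>(m, b) \<in> prog_J. arith_prog m b) \<and>
         (infinite {p. mersenne_prime p} \<longrightarrow>
          (\<Union>(m, b) \<in> prog_I. arith_prog m b) = (\<Union>(m, b) \<in> prog_K. arith_prog m b))"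
proof (intro conjI impI equalityI subsetI)
  fix n assume "n \<in> (\<Union>(m, b) \<in> prog_I. arith_prog m b)"
  then obtain m b where mb: "(m, b) \<in> prog_I" "n \<in> arith_prog m b" by blast
  obtain D where "(D, n) \<in> prog_J" using exists_prog_J[OF mb] by blast
  thus "n \<in> (\<Union>(m, b) \<in> prog_J. arith_prog m b)" using first_term_in_arith_prog by fast
next
  fix n assume inf: "infinite {p. mersenne_prime p}" and "n \<in> (\<Union>(m, b) \<in> prog_I. arith_prog m b)"
  then obtain m b where mb: "(m, b) \<in> prog_I" "n \<in> arith_prog m b" by blast
  obtain D where "(D, n) \<in> prog_K" using exists_prog_K[OF mb inf] by blast
  thus "n \<in> (\<Union>(m, b) \<in> prog_K. arith_prog m b)" using first_term_in_arith_prog by fast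
qed (auto simp: prog_J_def prog_K_def)

end
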